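(* Let $p$ be a prime and let $G\cong C_p^2$ be elementary abelian of order $p^2$. Then $\overline{\Gamma}(G)$ has $p+2$ vertices, with $\mathrm{Aut}(G)\cong\mathrm{GL}_2(p)$ and $\mathrm{Aut}^*(G)\cong\mathrm{PGL}_2(p)$. On the other hand, $\mathrm{Aut}(\overline{\Gamma}(G))$ and $\mathrm{Aut}(\overline{\Gamma}_{\mathrm w}(G))$ are both isomorphic to $\mathrm{S}_{p+1}$, fixing the isolated vertex corresponding to the identity. Furthermore, the group $\mathrm{Aut}(\Gamma(G))=\mathrm{S}_{p-1}\wr\mathrm{S}_{p+1}$.
   Context: The generating graph $\Gamma(G)$ of a finite group $G$ has vertex set $G$, with $x$ and $y$ joined if and only if $\langle x,y\rangle=G$ (loops occur only when $G$ is cyclic). For $x,y\in G$, $x\equiv_\Gamma y$ means that $x$ and $y$ have the same set of neighbours in $\Gamma(G)$. The reduced generating graph $\overline{\Gamma}(G)$ has as vertices the $\equiv_\Gamma$-classes, two classes being joined if their vertices are joined in $\Gamma(G)$. $\overline{\Gamma}_{\mathrm w}(G)$ is $\overline{\Gamma}(G)$ with each vertex weighted by the cardinality of the corresponding $\equiv_\Gamma$-class, and $\mathrm{Aut}(\overline{\Gamma}_{\mathrm w}(G))$ is the group of weight-preserving automorphisms of $\overline{\Gamma}(G)$. Automorphisms of $G$ permute the $\equiv_\Gamma$-classes, and $\mathrm{Aut}^*(G)$ denotes the group induced by $\mathrm{Aut}(G)$ on $\overline{\Gamma}(G)$. $\mathrm{S}_k$ is the symmetric group of degree $k$ and $\wr$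 denotes the (permutational) wreath product. *)

theory Defs
  imports
    "HOL-Algebra.Algebra"
    "HOL-Number_Theory.Residues"
    "Graph_Theory.Pair_Digraph"
begin

section \<open>Graphs and their automorphism groups\<close>

text \<open>An undirected graph, possibly with loops, is a vertex set together with a symmetric
  set of arcs. Automorphisms are extensional functions on the vertex set, as in
  \<^const>\<open>Bij\<close>, so that distinct functions are distinct permutations.\<close>

definition neighbours :: "('v, 'b) pair_pre_digraph_scheme \<Rightarrow> 'v \<Rightarrow> 'v set" where
  "neighbours \<Gamma> x = {y \<in> pverts \<Gamma>. (x, y) \<in> parcs \<Gamma>}"

definition isolated :: "('v, 'b) pair_pre_digraph_scheme \<Rightarrow> 'v \<Rightarrow> bool" where
  "isolated \<Gamma> x \<longleftrightarrow> x \<in> pverts \<Gamma> \<and> neighbours \<Gamma> x = {}"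

definition graph_auts :: "('v, 'b) pair_pre_digraph_scheme \<Rightarrow> ('v \<Rightarrow> 'v) set" where
  "graph_auts \<Gamma> = {f \<in> Bij (pverts \<Gamma>).
     \<forall>x \<in> pverts \<Gamma>. \<forall>y \<in> pverts \<Gamma>. (f x, f y) \<in> parcs \<Gamma> \<longleftrightarrow> (x, y) \<in> parcs \<Gamma>}"

definition graph_Aut :: "('v, 'b) pair_pre_digraph_scheme \<Rightarrow> ('v \<Rightarrow> 'v) monoid" where
  "graph_Aut \<Gamma> = BijGroup (pverts \<Gamma>) \<lparr>carrier := graph_auts \<Gamma>\<rparr>"

record 'v weighted_graph = "'v pair_pre_digraph" +
  weight :: "'v \<Rightarrow> nat"

definition weighted_graph_auts :: "('v, 'b) weighted_graph_scheme \<Rightarrow> ('v \<Rightarrow> 'v) set" where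
  "weighted_graph_auts \<Gamma> = {f \<in> graph_auts \<Gamma>. \<forall>x \<in> pverts \<Gamma>. weight \<Gamma> (f x) = weight \<Gamma> x}"

definition weighted_graph_Aut :: "('v, 'b) weighted_graph_scheme \<Rightarrow> ('v \<Rightarrow> 'v) monoid" where
  "weighted_graph_Aut \<Gamma> = BijGroup (pverts \<Gamma>) \<lparr>carrier := weighted_graph_auts \<Gamma>\<rparr>"


section \<open>Generating graphs\<close>

definition gen_graph :: "('a, 'b) monoid_scheme \<Rightarrow> 'a pair_pre_digraph" where
  "gen_graph G = \<lparr>pverts = carrier G,
     parcs = {(x, y) \<in> carrier G \<times> carrier G. generate G {x, y} = carrier G}\<rparr>"

definition gen_equiv :: "('a, 'b) monoid_scheme \<Rightarrow> 'a rel" where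
  "gen_equiv G = {(x, y) \<in> carrier G \<times> carrier G.
     neighbours (gen_graph G) x = neighbours (gen_graph G) y}"

definition reduced_gen_graph :: "('a, 'b) monoid_scheme \<Rightarrow> 'a set pair_pre_digraph" where
  "reduced_gen_graph G = \<lparr>pverts = carrier G // gen_equiv G,
     parcs = {(C, D) \<in> (carrier G // gen_equiv G) \<times> (carrier G // gen_equiv G).
       \<exists>x \<in> C. \<exists>y \<in> D. (x, y) \<in> parcs (gen_graph G)}\<rparr>"

definition weighted_reduced_gen_graph :: "('a, 'b) monoid_scheme \<Rightarrow> 'a set weighted_graph" where
  "weighted_reduced_gen_graph G =
     pair_pre_digraph.extend (reduced_gen_graph G) \<lparr>weight = card\<rparr>"

text \<open>The group $\mathrm{Aut}^*(G)$ of permutations of the vertices of the reduced generating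
  graph that are induced by automorphisms of $G$.\<close>

definition induced_Aut :: "('a, 'b) monoid_scheme \<Rightarrow> ('a set \<Rightarrow> 'a set) monoid" where
  "induced_Aut G = BijGroup (pverts (reduced_gen_graph G))
     \<lparr>carrier := (\<lambda>\<phi>. \<lambda>C \<in> pverts (reduced_gen_graph G). \<phi> ` C) ` auto G\<rparr>"


section \<open>Linear groups and wreath products\<close>

definition matrix_monoid :: "nat \<Rightarrow> ('r, 'm) ring_scheme \<Rightarrow> (nat \<Rightarrow> nat \<Rightarrow> 'r) monoid" where
  "matrix_monoid n R =
     \<lparr>carrier = {..<n} \<rightarrow>\<^sub>E {..<n} \<rightarrow>\<^sub>E carrier R,
      monoid.mult = (\<lambda>A B. \<lambda>i \<in> {..<n}. \<lambda>j \<in> {..<n}. \<Oplus>\<^bsub>R\<^esub>k \<in> {..<n}. A i k \<otimes>\<^bsub>R\<^esub> B k j),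
      one = (\<lambda>i \<in> {..<n}. \<lambda>j \<in> {..<n}. if i = j then \<one>\<^bsub>R\<^esub> else \<zero>\<^bsub>R\<^esub>)\<rparr>"

definition GL :: "nat \<Rightarrow> ('r, 'm) ring_scheme \<Rightarrow> (nat \<Rightarrow> nat \<Rightarrow> 'r) monoid" where
  "GL n R = units_of (matrix_monoid n R)"

definition scalar_matrices :: "nat \<Rightarrow> ('r, 'm) ring_scheme \<Rightarrow> (nat \<Rightarrow> nat \<Rightarrow> 'r) set" where
  "scalar_matrices n R =
     {\<lambda>i \<in> {..<n}. \<lambda>j \<in> {..<n}. if i = j then c else \<zero>\<^bsub>R\<^esub> | c. c \<in> carrier R}"

definition PGL :: "nat \<Rightarrow> ('r, 'm) ring_scheme \<Rightarrow> (nat \<Rightarrow> nat \<Rightarrow> 'r) set monoid" where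
  "PGL n R = GL n R Mod (carrier (GL n R) \<inter> scalar_matrices n R)"

text \<open>The permutational wreath product $K \wr H = K^\Omega \rtimes H$ of a group $K$ with a group
  $H$ of permutations of $\Omega$. The top group acts on the base group by permuting
  coordinates, $(\sigma \cdot g)(i) = g(\sigma^{-1}(i))$.\<close>

definition wreath_product ::
  "('k, 'b) monoid_scheme \<Rightarrow> ('i \<Rightarrow> 'i, 'c) monoid_scheme \<Rightarrow> 'i set \<Rightarrow>
   (('i \<Rightarrow> 'k) \<times> ('i \<Rightarrow> 'i)) monoid" where
  "wreath_product K H \<Omega> =
     (let B = product_group \<Omega> (\<lambda>_. K) in
       \<lparr>carrier = carrier B \<times> carrier H,
        monoid.mult = (\<lambda>(f, \<sigma>) (g, \<tau>).
          (f \<otimes>\<^bsub>B\<^esub> (\<lambda>i \<in> \<Omega>. g ((inv\<^bsub>H\<^esub> \<sigma>) i)), \<sigma> \<otimes>\<^bsub>H\<^esub> \<tau>)),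
        one = (\<one>\<^bsub>B\<^esub>, \<one>\<^bsub>H\<^esub>)\<rparr>)"

end

theory Submission
  imports Defs
begin

text \<open>Two elements generate $G$ iff both are nontrivial and they span different subgroups of
  order $p$. So $\Gamma(G)$ is an isolated vertex together with the complete multipartite graph
  whose $p+1$ parts are the sets of $p-1$ generators of the subgroups of order $p$, and the parts
  are the nontrivial $\equiv_\Gamma$-classes. The automorphism group of such a graph is a wreath
  product; for parts of size $1$, which is the reduced graph, it is symmetric. Choosing a basis
  identifies automorphisms of $G$ with invertible matrices, and those acting trivially on the
  subgroups of order $p$ are the scalars.\<close>

section \<open>Automorphisms of complete multipartite graphs\<close>

text \<open>Both graphs are instances of one locale with the same number of parts, so the wreath
  product is computed only once. Its hypotheses pin down what makes the description rigid: the
  isolated vertex is the only one, hence fixed, and non-adjacency of the remaining vertices is the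
  relation of lying in the same part, hence parts go to parts. The number of parts comes from p^2 -
  1 = (p - 1)(p + 1). Since all nontrivial classes have size p - 1, every automorphism of the
  reduced graph preserves the weights.

  For the linear groups, the monoid laws of matrices are transported from composition of
  endomorphisms, which replaces computations with double sums by associativity of composition. The
  projective group then comes from the first isomorphism theorem for the composite GL -> Aut(G) ->
  Aut*(G). An automorphism lies in the kernel iff it moves every element within its class, and this
  is a condition on the images of cyclic subgroups that can be tested on three elements.\<close>

lemma iso_inv_into:
  assumes "h \<in> iso G H" and "\<And>x y. \<lbrakk>x \<in> carrier G; y \<in> carrier G\<rbrakk> \<Longrightarrow> x \<otimes>\<^bsub>G\<^esub> y \<in> carrier G"
  shows "inv_into (carrier G) h \<in> iso H G"
proof (rule isoI)
  have h: "h \<in> hom G H" "bij_betw h (carrier G) (carrier H)"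
    using assms(1) by (auto simp: iso_def)
  show bij: "bij_betw (inv_into (carrier G) h) (carrier H) (carrier G)"
    using h(2) by (rule bij_betw_inv_into)
  show "inv_into (carrier G) h \<in> hom H G"
  proof (rule homI)
    fix x y assume xy: "x \<in> carrier H" "y \<in> carrier H"
    let ?x = "inv_into (carrier G) h x" and ?y = "inv_into (carrier G) h y"
    have in_G: "?x \<in> carrier G" "?y \<in> carrier G"
      using bij xy by (auto dest: bij_betwE)
    have "h (?x \<otimes>\<^bsub>G\<^esub> ?y) = x \<otimes>\<^bsub>H\<^esub> y"
      using in_G xy h by (simp add: hom_mult bij_betw_inv_into_right)
    then show "inv_into (carrier G) h (x \<otimes>\<^bsub>H\<^esub> y) = ?x \<otimes>\<^bsub>G\<^esub> ?y"
      using h(2) assms(2)[OF in_G] by (metis bij_betw_inv_into_left)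
  qed (use bij in \<open>auto dest: bij_betwE\<close>)
qed

section \<open>Automorphisms of arbitrary graphs\<close>

lemma carrier_graph_Aut [simp]: "carrier (graph_Aut \<Gamma>) = graph_auts \<Gamma>"
  by (simp add: graph_Aut_def)

lemma graph_auts_subset_Bij: "graph_auts \<Gamma> \<subseteq> Bij (pverts \<Gamma>)"
  by (auto simp: graph_auts_def)

lemma mult_graph_Aut:
  "f \<in> graph_auts \<Gamma> \<Longrightarrow> g \<in> graph_auts \<Gamma> \<Longrightarrow> f \<otimes>\<^bsub>graph_Aut \<Gamma>\<^esub> g = compose (pverts \<Gamma>) f g"
  using graph_auts_subset_Bij by (fastforce simp: graph_Aut_def BijGroup_def)

lemma graph_autsD:
  assumes "f \<in> graph_auts \<Gamma>"
  shows "f \<in> extensional (pverts \<Gamma>)" "bij_betw f (pverts \<Gamma>) (pverts \<Gamma>)"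
    and "x \<in> pverts \<Gamma> \<Longrightarrow> f x \<in> pverts \<Gamma>"
    and "x \<in> pverts \<Gamma> \<Longrightarrow> y \<in> pverts \<Gamma> \<Longrightarrow> (f x, f y) \<in> parcs \<Gamma> \<longleftrightarrow> (x, y) \<in> parcs \<Gamma>"
  using assms by (auto simp: graph_auts_def Bij_def bij_betw_def)

lemma neighbours_graph_aut:
  assumes f: "f \<in> graph_auts \<Gamma>" and x: "x \<in> pverts \<Gamma>"
  shows "neighbours \<Gamma> (f x) = f ` neighbours \<Gamma> x"
proof -
  have "f ` pverts \<Gamma> = pverts \<Gamma>"
    using graph_autsD(2)[OF f] by (simp add: bij_betw_def)
  then show ?thesis
    using graph_autsD(4)[OF f x] by (auto simp: neighbours_def image_iff) (metis imageE)
qed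

lemma isolated_graph_aut:
  assumes "f \<in> graph_auts \<Gamma>" "x \<in> pverts \<Gamma>"
  shows "isolated \<Gamma> (f x) \<longleftrightarrow> isolated \<Gamma> x"
  using assms by (simp add: isolated_def neighbours_graph_aut graph_autsD)

text \<open>The label \<open>\<beta> (i, a)\<close> is position \<open>a\<close> of part
  \<open>i\<close>. Labels are numbers because \<open>sym_group k\<close> permutes
  \<open>{1..k}\<close>. With a single part every vertex would be isolated, whence
  \<open>2 \<le> n\<close>; \<open>1 \<le> m\<close> makes every part nonempty, so that a
  permutation of the parts can be read off from the vertices.\<close>

locale multipartite_with_isolated =
  fixes \<Gamma> :: "('v, 'b) pair_pre_digraph_scheme" and z :: 'v and \<beta> :: "nat \<times> nat \<Rightarrow> 'v"
    and n m :: nat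
  assumes n: "2 \<le> n" and m: "1 \<le> m"
    and z: "z \<in> pverts \<Gamma>"
    and bij: "bij_betw \<beta> ({1..n} \<times> {1..m}) (pverts \<Gamma> - {z})"
    and no_arc: "\<And>y. (z, y) \<notin> parcs \<Gamma>" "\<And>y. (y, z) \<notin> parcs \<Gamma>"
    and arc: "\<And>i a j b. \<lbrakk>i \<in> {1..n}; a \<in> {1..m}; j \<in> {1..n}; b \<in> {1..m}\<rbrakk> \<Longrightarrow>
      (\<beta> (i, a), \<beta> (j, b)) \<in> parcs \<Gamma> \<longleftrightarrow> i \<noteq> j"
begin

declare One_nat_def [simp del]

abbreviation (input) "W \<equiv> {1..n} \<times> {1..m}"

lemma vert_cases:
  assumes "x \<in> pverts \<Gamma>"
  obtains "x = z" | i a where "i \<in> {1..n}" "a \<in> {1..m}" "x = \<beta> (i, a)"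
proof (cases "x = z")
  case False
  then have "x \<in> \<beta> ` W"
    using assms bij by (simp add: bij_betw_def)
  then show ?thesis using that(2) by blast
qed (rule that(1))

lemma \<beta>_vert: "i \<in> {1..n} \<Longrightarrow> a \<in> {1..m} \<Longrightarrow> \<beta> (i, a) \<in> pverts \<Gamma> \<and> \<beta> (i, a) \<noteq> z"
  using bij by (auto simp: bij_betw_def)

lemma \<beta>_inj:
  "\<lbrakk>i \<in> {1..n}; a \<in> {1..m}; j \<in> {1..n}; b \<in> {1..m}; \<beta> (i, a) = \<beta> (j, b)\<rbrakk> \<Longrightarrow> i = j \<and> a = b"
  using bij inj_onD[of \<beta> W "(i, a)" "(j, b)"] by (simp add: bij_betw_def)

text \<open>A vertex of part \<open>i\<close> is adjacent to all vertices of any other part;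
  \<open>j\<close> is such a part, and it exists because \<open>2 \<le> n\<close>.\<close>

lemma isolated_iff: "isolated \<Gamma> x \<longleftrightarrow> x = z"
proof
  show "isolated \<Gamma> x" if "x = z"
    using that z no_arc by (auto simp: isolated_def neighbours_def)
next
  assume x: "isolated \<Gamma> x"
  then have "x \<in> pverts \<Gamma>" by (simp add: isolated_def)
  then show "x = z"
  proof (cases rule: vert_cases)
    case (2 i a)
    note ia = this
    define j :: nat where "j = (if i = 1 then 2 else 1)"
    have j: "j \<in> {1..n}" "j \<noteq> i"
      using n by (auto simp: j_def)
    show ?thesis
      using x \<beta>_vert[OF j(1) ia(2)] arc[OF ia(1,2) j(1) ia(2)] j(2)
      unfolding isolated_def neighbours_def ia(3) by blast
  qed
qed

lemma graph_aut_fixes: "f \<in> graph_auts \<Gamma> \<Longrightarrow> f z = z"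
  using isolated_graph_aut[OF _ z] by (simp add: isolated_iff)

text \<open>The permutation of a part is read at the image index $\sigma(i)$, since the top group acts
  on the base group by $(\sigma \cdot g)(i) = g(\sigma^{-1}(i))$.\<close>

definition act :: "(nat \<Rightarrow> nat \<Rightarrow> nat) \<times> (nat \<Rightarrow> nat) \<Rightarrow> 'v \<Rightarrow> 'v" where
  "act = (\<lambda>(f, \<sigma>). \<lambda>x \<in> pverts \<Gamma>. if x = z then z
     else (let (i, a) = inv_into W \<beta> x in \<beta> (\<sigma> i, f (\<sigma> i) a)))"

lemma act_z: "act (f, \<sigma>) z = z"
  by (simp add: act_def z)

lemma act_\<beta>: "i \<in> {1..n} \<Longrightarrow> a \<in> {1..m} \<Longrightarrow> act (f, \<sigma>) (\<beta> (i, a)) = \<beta> (\<sigma> i, f (\<sigma> i) a)"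
  using \<beta>_vert[of i a] bij by (simp add: act_def bij_betw_def)

abbreviation "wr \<equiv> wreath_product (sym_group m) (sym_group n) {1..n}"

lemma carrier_wr: "(f, \<sigma>) \<in> carrier wr \<longleftrightarrow>
    f \<in> {1..n} \<rightarrow>\<^sub>E {\<pi>. \<pi> permutes {1..m}} \<and> \<sigma> permutes {1..n}"
  by (simp add: wreath_product_def Let_def sym_group_def)

text \<open>Adjacency of labelled vertices depends only on whether their parts differ, and the
  injective \<open>\<sigma>\<close> preserves this. Injectivity of \<open>\<sigma>\<close> and of
  each \<open>f k\<close> makes the action injective, and finiteness of the vertex set makes it
  surjective.\<close>

lemma act_auts:
  assumes "(f, \<sigma>) \<in> carrier wr"
  shows "act (f, \<sigma>) \<in> graph_auts \<Gamma>"
proof -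
  have f: "f i permutes {1..m}" if "i \<in> {1..n}" for i
    using assms that unfolding carrier_wr by auto
  have \<sigma>: "\<sigma> permutes {1..n}"
    using assms unfolding carrier_wr by auto
  note in_n = permutes_in_image[OF \<sigma>, THEN iffD2]
  have in_m: "f (\<sigma> i) a \<in> {1..m}" if "i \<in> {1..n}" "a \<in> {1..m}" for i a
    using permutes_in_image[OF f[OF in_n[OF that(1)]]] that by blast
  have verts: "act (f, \<sigma>) x \<in> pverts \<Gamma>" if "x \<in> pverts \<Gamma>" for x
    using that by (cases rule: vert_cases) (simp_all add: act_z z act_\<beta> \<beta>_vert in_n in_m del: atLeastAtMost_iff)
  have "inj_on (act (f, \<sigma>)) (pverts \<Gamma>)"
  proof (rule inj_onI)
    fix x y assume x: "x \<in> pverts \<Gamma>" and y: "y \<in> pverts \<Gamma>" and e: "act (f, \<sigma>) x = act (f, \<sigma>) y"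
    show "x = y"
      using x
    proof (cases rule: vert_cases)
      case 1
      from y show ?thesis
      proof (cases rule: vert_cases)
        case (2 j b)
        then show ?thesis using e \<beta>_vert[OF in_n in_m, of j j b] by (simp add: 1 act_z act_\<beta>)
      qed (use 1 in simp)
    next
      case i: (2 i a)
      from y show ?thesis
      proof (cases rule: vert_cases)
        case 1
        then show ?thesis using e i \<beta>_vert[OF in_n in_m, of i i a] by (simp add: 1 act_z act_\<beta>)
      next
        case j: (2 j b)
        have *: "\<sigma> i = \<sigma> j \<and> f (\<sigma> i) a = f (\<sigma> j) b"
          using e i j by (intro \<beta>_inj in_n in_m) (simp_all add: act_\<beta>)
        then have "i = j"
          using permutes_inj[OF \<sigma>] by (simp add: inj_eq)
        moreover from this have "a = b"
          using * injD[OF permutes_inj[OF f[OF in_n[OF i(1)]]], of a b] by simp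
        ultimately show ?thesis using i j by simp
      qed
    qed
  qed
  moreover have "act (f, \<sigma>) ` pverts \<Gamma> = pverts \<Gamma>"
  proof (rule endo_inj_surj)
    have "finite (pverts \<Gamma> - {z})" using bij bij_betw_finite by blast
    then show "finite (pverts \<Gamma>)" by simp
  qed (use verts calculation in auto)
  moreover have "(act (f, \<sigma>) x, act (f, \<sigma>) y) \<in> parcs \<Gamma> \<longleftrightarrow> (x, y) \<in> parcs \<Gamma>"
    if x: "x \<in> pverts \<Gamma>" and y: "y \<in> pverts \<Gamma>" for x y
    using x
  proof (cases rule: vert_cases)
    case i: (2 i a)
    from y show ?thesis
    proof (cases rule: vert_cases)
      case j: (2 j b)
      then show ?thesis
        using i permutes_inj[OF \<sigma>] by (simp add: act_\<beta> arc in_n in_m inj_eq del: atLeastAtMost_iff)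
    qed (simp add: act_z no_arc)
  qed (simp add: act_z no_arc)
  ultimately show ?thesis
    by (auto simp: graph_auts_def Bij_def bij_betw_def) (simp add: act_def)
qed

lemma eq_if_eq_on_\<beta>:
  assumes "h \<in> graph_auts \<Gamma>" "k \<in> graph_auts \<Gamma>"
    and "\<And>i a. i \<in> {1..n} \<Longrightarrow> a \<in> {1..m} \<Longrightarrow> h (\<beta> (i, a)) = k (\<beta> (i, a))"
  shows "h = k"
proof (rule extensionalityI[of _ "pverts \<Gamma>"])
  fix x assume "x \<in> pverts \<Gamma>"
  then show "h x = k x"
    by (cases rule: vert_cases) (simp_all add: assms graph_aut_fixes)
qed (use assms graph_autsD in auto)

text \<open>Here \<open>\<gamma> i a\<close> is the label of the image of
  \<open>\<beta> (i, a)\<close> under \<open>h\<close>. Its first component depends on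
  \<open>i\<close> alone and gives \<open>\<sigma>\<close>; what is left is one permutation of
  positions for each part.\<close>

lemma act_surj:
  assumes h: "h \<in> graph_auts \<Gamma>"
  shows "\<exists>w \<in> carrier wr. act w = h"
proof -
  define \<gamma> where "\<gamma> i a = inv_into W \<beta> (h (\<beta> (i, a)))" for i a
  have hv: "h (\<beta> (i, a)) \<in> \<beta> ` W" if "i \<in> {1..n}" "a \<in> {1..m}" for i a
  proof -
    have "h (\<beta> (i, a)) \<noteq> h z"
      using graph_autsD(2)[OF h] \<beta>_vert[OF that] z by (auto simp: bij_betw_def dest: inj_onD)
    then show ?thesis
      using bij graph_autsD(3)[OF h] graph_aut_fixes[OF h] \<beta>_vert[OF that]
      by (simp add: bij_betw_def)
  qed
  have \<gamma>W: "\<gamma> i a \<in> W" and \<beta>\<gamma>: "\<beta> (\<gamma> i a) = h (\<beta> (i, a))" if "i \<in> {1..n}" "a \<in> {1..m}" for i a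
    using hv[OF that] by (simp_all add: \<gamma>_def inv_into_into f_inv_into_f del: mem_Sigma_iff)
  \<comment> \<open>Being in the same part is the same as not being adjacent, which \<open>h\<close>
    preserves in both directions.\<close>
  have fst_eq: "fst (\<gamma> i a) = fst (\<gamma> j b) \<longleftrightarrow> i = j"
    if "i \<in> {1..n}" "a \<in> {1..m}" "j \<in> {1..n}" "b \<in> {1..m}" for i a j b
  proof -
    have "(\<beta> (\<gamma> i a), \<beta> (\<gamma> j b)) \<in> parcs \<Gamma> \<longleftrightarrow> fst (\<gamma> i a) \<noteq> fst (\<gamma> j b)"
      using arc[of "fst (\<gamma> i a)" "snd (\<gamma> i a)" "fst (\<gamma> j b)" "snd (\<gamma> j b)"] \<gamma>W[OF that(1,2)] \<gamma>W[OF that(3,4)]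
      by (simp add: mem_Times_iff)
    moreover have "(\<beta> (\<gamma> i a), \<beta> (\<gamma> j b)) \<in> parcs \<Gamma> \<longleftrightarrow> i \<noteq> j"
      using that by (simp add: \<beta>\<gamma> graph_autsD(4)[OF h] \<beta>_vert arc del: atLeastAtMost_iff)
    ultimately show ?thesis by simp
  qed
  have m1: "1 \<in> {1..m}" using m by simp
  \<comment> \<open>Position 1 represents its part. Outside \<open>{1..n}\<close> the map has to be
    the identity, as \<open>permutes\<close> demands.\<close>
  define \<sigma> where "\<sigma> i = (if i \<in> {1..n} then fst (\<gamma> i 1) else i)" for i
  have \<sigma>_in: "\<sigma> i \<in> {1..n}" if "i \<in> {1..n}" for i
    using \<gamma>W[OF that m1] that by (simp add: \<sigma>_def mem_Times_iff)
  have "inj_on \<sigma> {1..n}"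
    using fst_eq m1 by (auto simp: \<sigma>_def inj_on_def)
  then have \<sigma>: "\<sigma> permutes {1..n}"
    using endo_inj_surj[of "{1..n}" \<sigma>] \<sigma>_in
    by (intro bij_imp_permutes) (auto simp: bij_betw_def image_subset_iff, auto simp: \<sigma>_def)
  have fst_\<gamma>: "fst (\<gamma> i a) = \<sigma> i" if "i \<in> {1..n}" "a \<in> {1..m}" for i a
    using fst_eq[OF that that(1) m1] that by (simp add: \<sigma>_def)
  \<comment> \<open>Components are indexed by the image part: the part sent to part \<open>k\<close>
    is \<open>inv' \<sigma> k\<close>, so its positions are the ones to follow.\<close>
  define f where "f = (\<lambda>k \<in> {1..n}. \<lambda>a. if a \<in> {1..m} then snd (\<gamma> (inv' \<sigma> k) a) else a)"
  have f_perm: "f k permutes {1..m}" if k: "k \<in> {1..n}" for k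
  proof -
    define i where "i = inv' \<sigma> k"
    have i: "i \<in> {1..n}"
      using permutes_in_image[OF permutes_inv[OF \<sigma>]] k by (simp add: i_def)
    have "f k a \<in> {1..m}" if "a \<in> {1..m}" for a
      using \<gamma>W[OF i that] that k by (simp add: f_def i_def mem_Times_iff)
    moreover have "inj_on (f k) {1..m}"
    proof (rule inj_onI)
      fix a b assume ab: "a \<in> {1..m}" "b \<in> {1..m}" "f k a = f k b"
      then have "\<gamma> i a = \<gamma> i b"
        using k fst_\<gamma>[OF i] by (simp add: f_def i_def[symmetric] prod_eq_iff)
      then have "h (\<beta> (i, a)) = h (\<beta> (i, b))"
        using \<beta>\<gamma> i ab by metis
      then have "\<beta> (i, a) = \<beta> (i, b)"
        using graph_autsD(2)[OF h] \<beta>_vert i ab by (auto simp: bij_betw_def dest!: inj_onD)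
      then show "a = b" using \<beta>_inj i ab by blast
    qed
    ultimately show ?thesis
      using k endo_inj_surj[of "{1..m}" "f k"]
      by (intro bij_imp_permutes) (auto simp: bij_betw_def image_subset_iff, auto simp: f_def)
  qed
  have w: "(f, \<sigma>) \<in> carrier wr"
    unfolding carrier_wr using f_perm \<sigma> by (auto simp: f_def)
  have "act (f, \<sigma>) = h"
  proof (rule eq_if_eq_on_\<beta>[OF act_auts[OF w] h])
    fix i a assume ia: "i \<in> {1..n}" "a \<in> {1..m}"
    have "inv' \<sigma> (\<sigma> i) = i" using permutes_inverses[OF \<sigma>] by simp
    then have "f (\<sigma> i) a = snd (\<gamma> i a)"
      using ia \<sigma>_in[OF ia(1)] by (simp add: f_def)
    then show "act (f, \<sigma>) (\<beta> (i, a)) = h (\<beta> (i, a))"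
      using \<beta>\<gamma>[OF ia] fst_\<gamma>[OF ia] by (simp add: act_\<beta> ia del: atLeastAtMost_iff) (metis prod.collapse)
  qed
  with w show ?thesis by blast
qed

text \<open>Position 1 of each part already determines \<open>\<sigma>\<close>. As
  \<open>\<sigma>\<close> reaches every index \<open>k\<close>, the images of the vertices of the
  part sent to \<open>k\<close> determine \<open>f k\<close>. Outside the index ranges all values
  are prescribed by \<open>permutes\<close> and extensionality.\<close>

lemma act_inj: "inj_on act (carrier wr)"
proof (rule inj_onI, clarify)
  fix f \<sigma> g \<tau> assume w: "(f, \<sigma>) \<in> carrier wr" "(g, \<tau>) \<in> carrier wr" and e: "act (f, \<sigma>) = act (g, \<tau>)"
  have \<sigma>: "\<sigma> permutes {1..n}" and \<tau>: "\<tau> permutes {1..n}"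
    and f: "f \<in> {1..n} \<rightarrow>\<^sub>E {\<pi>. \<pi> permutes {1..m}}" and g: "g \<in> {1..n} \<rightarrow>\<^sub>E {\<pi>. \<pi> permutes {1..m}}"
    using w unfolding carrier_wr by auto
  have f': "f i permutes {1..m}" and g': "g i permutes {1..m}" if "i \<in> {1..n}" for i
    using PiE_mem[OF f that] PiE_mem[OF g that] by simp_all
  have *: "\<sigma> i = \<tau> i \<and> f (\<sigma> i) a = g (\<tau> i) a" if ia: "i \<in> {1..n}" "a \<in> {1..m}" for i a
  proof (rule \<beta>_inj)
    show "\<beta> (\<sigma> i, f (\<sigma> i) a) = \<beta> (\<tau> i, g (\<tau> i) a)"
      using fun_cong[OF e, of "\<beta> (i, a)"] by (simp add: act_\<beta> ia del: atLeastAtMost_iff)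
    show s: "\<sigma> i \<in> {1..n}" "\<tau> i \<in> {1..n}"
      using permutes_in_image[OF \<sigma>] permutes_in_image[OF \<tau>] ia by blast+
    show "f (\<sigma> i) a \<in> {1..m}" "g (\<tau> i) a \<in> {1..m}"
      using permutes_in_image[OF f'[OF s(1)]] permutes_in_image[OF g'[OF s(2)]] ia by blast+
  qed
  have m1: "1 \<in> {1..m}" using m by simp
  have st: "\<sigma> = \<tau>"
  proof
    show "\<sigma> i = \<tau> i" for i
      using *[OF _ m1, of i] permutes_not_in[OF \<sigma>, of i] permutes_not_in[OF \<tau>, of i]
      by (cases "i \<in> {1..n}") (simp_all del: atLeastAtMost_iff)
  qed
  have "f k = g k" if k: "k \<in> {1..n}" for k
  proof
    fix a
    obtain i where i: "i \<in> {1..n}" "\<sigma> i = k"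
      using permutes_image[OF \<sigma>] k by (metis imageE)
    show "f k a = g k a"
      using *[OF i(1), of a] i(2) st permutes_not_in[OF f'[OF k], of a] permutes_not_in[OF g'[OF k], of a]
      by (cases "a \<in> {1..m}") (simp_all del: atLeastAtMost_iff)
  qed
  then have "f = g" by (rule PiE_ext[OF f g])
  with st show "f = g \<and> \<sigma> = \<tau>" by simp
qed

text \<open>Applying \<open>(g, \<tau>)\<close> and then \<open>(f, \<sigma>)\<close> sends position
  \<open>a\<close> of part \<open>i\<close> to position \<open>f k (g (\<tau> i) a)\<close> of part
  \<open>k = \<sigma> (\<tau> i)\<close>. Since \<open>\<tau> i = inv' \<sigma> k\<close>, the
  component at \<open>k\<close> is \<open>f k \<circ> g (inv' \<sigma> k)\<close>, the twisted
  product of the wreath product.\<close>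

lemma act_mult:
  assumes w: "(f, \<sigma>) \<in> carrier wr" "(g, \<tau>) \<in> carrier wr"
  shows "(f, \<sigma>) \<otimes>\<^bsub>wr\<^esub> (g, \<tau>) \<in> carrier wr"
    and "act ((f, \<sigma>) \<otimes>\<^bsub>wr\<^esub> (g, \<tau>)) = act (f, \<sigma>) \<otimes>\<^bsub>graph_Aut \<Gamma>\<^esub> act (g, \<tau>)"
proof -
  have \<sigma>: "\<sigma> permutes {1..n}" and \<tau>: "\<tau> permutes {1..n}"
    and f: "f \<in> {1..n} \<rightarrow>\<^sub>E {\<pi>. \<pi> permutes {1..m}}" and g: "g \<in> {1..n} \<rightarrow>\<^sub>E {\<pi>. \<pi> permutes {1..m}}"
    using w unfolding carrier_wr by auto
  have f': "f i permutes {1..m}" and g': "g i permutes {1..m}" if "i \<in> {1..n}" for i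
    using PiE_mem[OF f that] PiE_mem[OF g that] by simp_all
  have inv: "inv\<^bsub>sym_group n\<^esub> \<sigma> = inv' \<sigma>"
    using \<sigma> by (intro group.inv_equality[OF sym_group_is_group])
      (auto simp: sym_group_def permutes_inv permutes_inv_o)
  have inv_in: "inv' \<sigma> k \<in> {1..n}" if "k \<in> {1..n}" for k
    using permutes_in_image[OF permutes_inv[OF \<sigma>]] that by blast
  have mult: "(f, \<sigma>) \<otimes>\<^bsub>wr\<^esub> (g, \<tau>) = (\<lambda>i \<in> {1..n}. f i \<circ> g (inv' \<sigma> i), \<sigma> \<circ> \<tau>)"
    by (auto simp: wreath_product_def Let_def inv sym_group_mult restrict_def fun_eq_iff)
  show c: "(f, \<sigma>) \<otimes>\<^bsub>wr\<^esub> (g, \<tau>) \<in> carrier wr"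
    unfolding mult carrier_wr using \<sigma> \<tau> f' g' inv_in
    by (auto simp: permutes_compose simp del: atLeastAtMost_iff intro!: permutes_compose)
  have prod: "act (f, \<sigma>) \<otimes>\<^bsub>graph_Aut \<Gamma>\<^esub> act (g, \<tau>) = compose (pverts \<Gamma>) (act (f, \<sigma>)) (act (g, \<tau>))"
    using w by (intro mult_graph_Aut act_auts)
  show "act ((f, \<sigma>) \<otimes>\<^bsub>wr\<^esub> (g, \<tau>)) = act (f, \<sigma>) \<otimes>\<^bsub>graph_Aut \<Gamma>\<^esub> act (g, \<tau>)"
    unfolding prod mult
  proof (rule extensionalityI[of _ "pverts \<Gamma>"])
    fix x assume x: "x \<in> pverts \<Gamma>"
    then show "act (\<lambda>i \<in> {1..n}. f i \<circ> g (inv' \<sigma> i), \<sigma> \<circ> \<tau>) x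
        = compose (pverts \<Gamma>) (act (f, \<sigma>)) (act (g, \<tau>)) x"
    proof (cases rule: vert_cases)
      case 1
      then show ?thesis using x by (simp add: act_z compose_def)
    next
      case (2 i a)
      have t: "\<tau> i \<in> {1..n}" using permutes_in_image[OF \<tau>] 2 by blast
      then have "\<sigma> (\<tau> i) \<in> {1..n}" "g (\<tau> i) a \<in> {1..m}"
        using permutes_in_image[OF \<sigma>] permutes_in_image[OF g'[OF t]] 2 by blast+
      then show ?thesis
        using x 2 t permutes_inverses[OF \<sigma>] by (simp add: act_\<beta> compose_def del: atLeastAtMost_iff)
    qed
  qed (simp add: act_def, simp add: compose_def)
qed

lemma act_iso: "act \<in> iso wr (graph_Aut \<Gamma>)"
proof (rule isoI)
  show "act \<in> hom wr (graph_Aut \<Gamma>)"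
  proof (rule homI)
    fix v w assume "v \<in> carrier wr" "w \<in> carrier wr"
    then show "act (v \<otimes>\<^bsub>wr\<^esub> w) = act v \<otimes>\<^bsub>graph_Aut \<Gamma>\<^esub> act w"
      using act_mult(2)[of "fst v" "snd v" "fst w" "snd w"] by simp
  next
    fix v assume "v \<in> carrier wr"
    then show "act v \<in> carrier (graph_Aut \<Gamma>)"
      using act_auts[of "fst v" "snd v"] by simp
  qed
  have "act ` carrier wr = graph_auts \<Gamma>"
  proof (intro equalityI subsetI)
    fix h assume "h \<in> act ` carrier wr"
    then obtain w where "w \<in> carrier wr" "h = act w"
      by blast
    then show "h \<in> graph_auts \<Gamma>"
      using act_auts[of "fst w" "snd w"] by simp
  next
    fix h assume "h \<in> graph_auts \<Gamma>"
    then show "h \<in> act ` carrier wr" using act_surj by blast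
  qed
  then show "bij_betw act (carrier wr) (carrier (graph_Aut \<Gamma>))"
    using act_inj by (simp add: bij_betw_def)
qed

end

text \<open>Over a trivial \<open>K\<close> the base group consists of one constant function, so a
  pair is determined by its second component.\<close>

lemma snd_iso_wreath_product:
  assumes "carrier K = {k}"
  shows "snd \<in> iso (wreath_product K H \<Omega>) H"
proof (rule isoI)
  let ?B = "\<Pi>\<^sub>E i\<in>\<Omega>. carrier K"
  have "?B = {\<lambda>i\<in>\<Omega>. k}"
    using assms by (auto simp: fun_eq_iff PiE_iff extensional_def)
  then show "bij_betw snd (carrier (wreath_product K H \<Omega>)) (carrier H)"
    by (auto simp: wreath_product_def bij_betw_def inj_on_def image_iff)
  show "snd \<in> hom (wreath_product K H \<Omega>) H"
    by (rule homI) (auto simp: wreath_product_def Let_def)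
qed

context multipartite_with_isolated
begin

text \<open>\<open>act\<close> goes from the wreath product to the automorphisms. Inverting it by
  \<open>iso_inv_into\<close> needs only closure of the wreath product under multiplication, not its
  group laws.\<close>

lemma graph_Aut_wreath_product:
  "graph_Aut \<Gamma> \<cong> wreath_product (sym_group m) (sym_group n) {1..n}"
proof (rule is_isoI[OF iso_inv_into[OF act_iso]])
  fix v w assume "v \<in> carrier wr" "w \<in> carrier wr"
  then show "v \<otimes>\<^bsub>wr\<^esub> w \<in> carrier wr"
    using act_mult(1)[of "fst v" "snd v" "fst w" "snd w"] by simp
qed

lemma graph_Aut_sym_group:
  assumes "m = 1"
  shows "graph_Aut \<Gamma> \<cong> sym_group n"
proof -
  have "carrier (sym_group m) = {id}"
    using assms permutes_sing[of _ "1::nat"] by (auto simp: sym_group_def permutes_id)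
  then show ?thesis
    using iso_trans[OF graph_Aut_wreath_product is_isoI[OF snd_iso_wreath_product]] by blast
qed

end

section \<open>Generating graphs\<close>

text \<open>Produces the labelling required by \<open>multipartite_with_isolated\<close>:
  \<open>\<kappa>\<close> numbers the blocks, \<open>\<theta> C\<close> numbers the elements of the
  block \<open>C\<close>, and disjointness lets the block be recovered from an element.\<close>

lemma partition_indexing:
  fixes n m :: nat
  assumes "finite \<C>" "card \<C> = n" "\<And>C. C \<in> \<C> \<Longrightarrow> finite C \<and> card C = m"
    and disj: "\<And>C D. C \<in> \<C> \<Longrightarrow> D \<in> \<C> \<Longrightarrow> C \<noteq> D \<Longrightarrow> C \<inter> D = {}"
  obtains \<kappa> \<beta> where "bij_betw \<kappa> {1..n} \<C>" "bij_betw \<beta> ({1..n} \<times> {1..m}) (\<Union>\<C>)"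
    "\<And>i a. i \<in> {1..n} \<Longrightarrow> a \<in> {1..m} \<Longrightarrow> \<beta> (i, a) \<in> \<kappa> i"
proof -
  obtain \<kappa> where \<kappa>: "bij_betw \<kappa> {1..n} \<C>"
    using ex_bij_betw_nat_finite_1[OF assms(1)] assms(2) by blast
  have "\<exists>\<theta>. bij_betw \<theta> {1..m} C" if "C \<in> \<C>" for C
    using ex_bij_betw_nat_finite_1[of C] assms(3)[OF that] by auto
  then obtain \<theta> where \<theta>: "\<And>C. C \<in> \<C> \<Longrightarrow> bij_betw (\<theta> C) {1..m} C"
    by metis
  define \<beta> where "\<beta> = (\<lambda>(i, a). \<theta> (\<kappa> i) a)"
  have \<kappa>_in: "\<kappa> i \<in> \<C>" if "i \<in> {1..n}" for i
    using \<kappa> that by (rule bij_betwE[THEN bspec])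
  have mem: "\<beta> (i, a) \<in> \<kappa> i" if "i \<in> {1..n}" "a \<in> {1..m}" for i a
    using bij_betwE[OF \<theta>[OF \<kappa>_in[OF that(1)]]] that(2) by (simp add: \<beta>_def)
  have "inj_on \<beta> ({1..n} \<times> {1..m})"
  proof (rule inj_onI)
    fix v w assume v: "v \<in> {1..n} \<times> {1..m}" and w: "w \<in> {1..n} \<times> {1..m}" and eq: "\<beta> v = \<beta> w"
    obtain i a j b where vw: "v = (i, a)" "w = (j, b)" by fastforce
    have i: "i \<in> {1..n}" "a \<in> {1..m}" "j \<in> {1..n}" "b \<in> {1..m}"
      using v w unfolding vw by blast+
    have "\<kappa> i = \<kappa> j"
      using mem[OF i(1,2)] mem[OF i(3,4)] eq disj[OF \<kappa>_in[OF i(1)] \<kappa>_in[OF i(3)]]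
      unfolding vw by auto
    then have ij: "i = j"
      using bij_betw_imp_inj_on[OF \<kappa>] i by (meson inj_onD)
    then have "a = b"
      using bij_betw_imp_inj_on[OF \<theta>[OF \<kappa>_in[OF i(1)]]] i eq unfolding vw \<beta>_def
      by (simp add: inj_on_eq_iff)
    with ij show "v = w" by (simp add: vw)
  qed
  moreover have "\<beta> ` ({1..n} \<times> {1..m}) = \<Union>\<C>"
  proof (intro equalityI subsetI)
    fix x assume "x \<in> \<beta> ` ({1..n} \<times> {1..m})"
    then obtain i a where "i \<in> {1..n}" "a \<in> {1..m}" "x = \<beta> (i, a)" by blast
    then show "x \<in> \<Union>\<C>" using mem \<kappa>_in by blast
  next
    fix x assume "x \<in> \<Union>\<C>"
    then obtain C where C: "C \<in> \<C>" "x \<in> C" by blast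
    obtain i where i: "i \<in> {1..n}" "\<kappa> i = C"
      using C(1) bij_betw_imp_surj_on[OF \<kappa>] by (metis imageE)
    obtain a where a: "a \<in> {1..m}" "\<theta> C a = x"
      using C(2) bij_betw_imp_surj_on[OF \<theta>[OF C(1)]] by (metis imageE)
    have "\<beta> (i, a) = x" using i a by (simp add: \<beta>_def)
    then show "x \<in> \<beta> ` ({1..n} \<times> {1..m})" using i a by blast
  qed
  ultimately show ?thesis
    using that[OF \<kappa> _ mem] by (simp add: bij_betw_def)
qed

section \<open>Generating graphs of arbitrary groups\<close>

lemma pverts_gen_graph [simp]: "pverts (gen_graph G) = carrier G"
  by (simp add: gen_graph_def)

lemma parcs_gen_graph:
  "(x, y) \<in> parcs (gen_graph G) \<longleftrightarrow>
    x \<in> carrier G \<and> y \<in> carrier G \<and> generate G {x, y} = carrier G"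
  by (auto simp: gen_graph_def)

lemma pverts_reduced_gen_graph: "pverts (reduced_gen_graph G) = carrier G // gen_equiv G"
  by (simp add: reduced_gen_graph_def)

lemma parcs_reduced_gen_graph:
  "(C, D) \<in> parcs (reduced_gen_graph G) \<longleftrightarrow>
    C \<in> carrier G // gen_equiv G \<and> D \<in> carrier G // gen_equiv G \<and>
    (\<exists>x \<in> C. \<exists>y \<in> D. (x, y) \<in> parcs (gen_graph G))"
  by (simp add: reduced_gen_graph_def)

lemma equiv_gen_equiv: "equiv (carrier G) (gen_equiv G)"
  by (auto simp: gen_equiv_def intro!: equivI refl_onI symI transI)

text \<open>The neighbours of \<open>f x\<close> are the images of the neighbours of
  \<open>x\<close>, and an injective map takes two sets to the same image only if they are
  equal.\<close>

lemma graph_aut_gen_equiv_iff: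
  assumes f: "f \<in> graph_auts (gen_graph G)" and "x \<in> carrier G" "y \<in> carrier G"
  shows "(f x, f y) \<in> gen_equiv G \<longleftrightarrow> (x, y) \<in> gen_equiv G"
proof -
  have "inj_on f (carrier G)"
    using graph_autsD(2)[OF f] by (simp add: bij_betw_def)
  moreover have "neighbours (gen_graph G) z \<subseteq> carrier G" for z
    by (auto simp: neighbours_def)
  ultimately show ?thesis
    using assms(2,3) graph_autsD(3)[OF f]
    by (simp add: gen_equiv_def neighbours_graph_aut[OF f] inj_on_image_eq_iff)
qed

lemma graph_aut_image_class:
  assumes f: "f \<in> graph_auts (gen_graph G)" and x: "x \<in> carrier G"
  shows "f ` (gen_equiv G `` {x}) = gen_equiv G `` {f x}"
proof (intro equalityI subsetI)
  fix y assume "y \<in> f ` (gen_equiv G `` {x})"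
  then show "y \<in> gen_equiv G `` {f x}"
    using graph_aut_gen_equiv_iff[OF f x] by (auto simp: gen_equiv_def)
next
  fix y assume y: "y \<in> gen_equiv G `` {f x}"
  then have "y \<in> f ` carrier G"
    using graph_autsD(2)[OF f] by (auto simp: bij_betw_def gen_equiv_def)
  then show "y \<in> f ` (gen_equiv G `` {x})"
    using graph_aut_gen_equiv_iff[OF f x] y by auto
qed

text \<open>A homomorphism maps the subgroup generated by a pair onto the subgroup generated by the
  images; by bijectivity one is the whole group iff the other is.\<close>

lemma (in group) auto_subset_graph_auts: "auto G \<subseteq> graph_auts (gen_graph G)"
proof
  fix \<phi> assume \<phi>: "\<phi> \<in> auto G"
  then interpret group_hom G G \<phi>
    by unfold_locales (simp add: auto_def)
  have bij: "\<phi> \<in> Bij (carrier G)" "inj_on \<phi> (carrier G)" "\<phi> ` carrier G = carrier G"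
    using \<phi> by (auto simp: auto_def Bij_def bij_betw_def)
  have "generate G {\<phi> x, \<phi> y} = carrier G \<longleftrightarrow> generate G {x, y} = carrier G"
    if "x \<in> carrier G" "y \<in> carrier G" for x y
  proof -
    have "generate G {\<phi> x, \<phi> y} = \<phi> ` generate G {x, y}"
      using generate_img[of "{x, y}"] that by simp
    then show ?thesis
      using inj_on_image_eq_iff[OF bij(2), of "generate G {x, y}" "carrier G"] bij(3)
        generate_incl[of "{x, y}"] that by simp
  qed
  then show "\<phi> \<in> graph_auts (gen_graph G)"
    using bij by (auto simp: graph_auts_def parcs_gen_graph)
qed

section \<open>The action of the automorphism group on the classes\<close>

text \<open>Names the map whose image is the carrier of \<open>induced_Aut G\<close>, so that it can
  be treated as a homomorphism with a kernel.\<close>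

definition class_action :: "('a, 'b) monoid_scheme \<Rightarrow> ('a \<Rightarrow> 'a) \<Rightarrow> 'a set \<Rightarrow> 'a set" where
  "class_action G \<phi> = (\<lambda>C \<in> pverts (reduced_gen_graph G). \<phi> ` C)"

lemma carrier_induced_Aut: "carrier (induced_Aut G) = class_action G ` auto G"
  by (simp add: induced_Aut_def class_action_def[abs_def])

context group
begin

lemma class_action_class:
  "\<phi> \<in> auto G \<Longrightarrow> x \<in> carrier G \<Longrightarrow>
    class_action G \<phi> (gen_equiv G `` {x}) = gen_equiv G `` {\<phi> x}"
  using graph_aut_image_class auto_subset_graph_auts
  by (fastforce simp: class_action_def pverts_reduced_gen_graph quotientI)

lemma auto_inv:
  assumes "\<phi> \<in> auto G"
  obtains \<psi> where "\<psi> \<in> auto G" "\<And>x. x \<in> carrier G \<Longrightarrow> \<psi> (\<phi> x) = x \<and> \<phi> (\<psi> x) = x"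
proof
  let ?\<psi> = "\<lambda>x \<in> carrier G. inv_into (carrier G) \<phi> x"
  have bij: "\<phi> \<in> Bij (carrier G)" "bij_betw \<phi> (carrier G) (carrier G)"
    using assms by (auto simp: auto_def Bij_def)
  show "?\<psi> \<in> auto G"
    using assms restrict_inv_into_hom[of \<phi>] restrict_inv_into_Bij[of \<phi>] by (auto simp: auto_def)
  show "?\<psi> (\<phi> x) = x \<and> \<phi> (?\<psi> x) = x" if "x \<in> carrier G" for x
    using that bij_betw_inv_into_left[OF bij(2)] bij_betw_inv_into_right[OF bij(2)]
      bij_betwE[OF bij(2)] by simp
qed

lemma auto_closed: "\<phi> \<in> auto G \<Longrightarrow> x \<in> carrier G \<Longrightarrow> \<phi> x \<in> carrier G"
  by (auto simp: auto_def hom_def)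

text \<open>The inverse automorphism induces the inverse permutation of the classes.\<close>

lemma class_action_Bij:
  assumes \<phi>: "\<phi> \<in> auto G"
  shows "class_action G \<phi> \<in> Bij (pverts (reduced_gen_graph G))"
proof -
  obtain \<psi> where \<psi>: "\<psi> \<in> auto G" "\<And>x. x \<in> carrier G \<Longrightarrow> \<psi> (\<phi> x) = x \<and> \<phi> (\<psi> x) = x"
    using auto_inv[OF \<phi>] by blast
  have "bij_betw (class_action G \<phi>) (carrier G // gen_equiv G) (carrier G // gen_equiv G)"
  proof (rule bij_betw_byWitness[where f' = "class_action G \<psi>"])
    show "\<forall>C \<in> carrier G // gen_equiv G. class_action G \<psi> (class_action G \<phi> C) = C"
      "\<forall>C \<in> carrier G // gen_equiv G. class_action G \<phi> (class_action G \<psi> C) = C"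
      "class_action G \<phi> ` (carrier G // gen_equiv G) \<subseteq> carrier G // gen_equiv G"
      "class_action G \<psi> ` (carrier G // gen_equiv G) \<subseteq> carrier G // gen_equiv G"
      using \<phi> \<psi> quotientI[OF auto_closed[OF \<phi>]] quotientI[OF auto_closed[OF \<psi>(1)]]
      by (auto elim!: quotientE simp: class_action_class auto_closed)
  qed
  then show ?thesis
    by (simp add: Bij_def pverts_reduced_gen_graph) (simp add: class_action_def pverts_reduced_gen_graph)
qed

lemma mult_AutoGroup:
  "\<phi> \<in> auto G \<Longrightarrow> \<psi> \<in> auto G \<Longrightarrow> \<phi> \<otimes>\<^bsub>AutoGroup G\<^esub> \<psi> = compose (carrier G) \<phi> \<psi>"
  by (simp add: AutoGroup_def BijGroup_def auto_def)

lemma carrier_AutoGroup [simp]: "carrier (AutoGroup G) = auto G"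
  by (simp add: AutoGroup_def)

lemma auto_compose: "\<phi> \<in> auto G \<Longrightarrow> \<psi> \<in> auto G \<Longrightarrow> compose (carrier G) \<phi> \<psi> \<in> auto G"
  using monoid.m_closed[OF group.is_monoid[OF AutoGroup], of \<phi> \<psi>] by (simp add: mult_AutoGroup)

lemma class_action_compose:
  assumes "\<phi> \<in> auto G" "\<psi> \<in> auto G"
  shows "class_action G (compose (carrier G) \<phi> \<psi>) =
    compose (pverts (reduced_gen_graph G)) (class_action G \<phi>) (class_action G \<psi>)"
proof (rule extensionalityI)
  fix C assume C: "C \<in> pverts (reduced_gen_graph G)"
  then obtain x where x: "x \<in> carrier G" "C = gen_equiv G `` {x}"
    by (auto simp: pverts_reduced_gen_graph elim: quotientE)
  then show "class_action G (compose (carrier G) \<phi> \<psi>) C =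
      compose (pverts (reduced_gen_graph G)) (class_action G \<phi>) (class_action G \<psi>) C"
    using C assms by (simp add: compose_eq class_action_class auto_compose auto_closed)
qed (simp_all add: class_action_def[of G "compose (carrier G) \<phi> \<psi>"])

lemma class_action_hom_BijGroup:
  "class_action G \<in> hom (AutoGroup G) (BijGroup (pverts (reduced_gen_graph G)))"
  by (rule homI)
    (simp_all add: mult_AutoGroup class_action_compose class_action_Bij BijGroup_def)

text \<open>The carrier of \<open>induced_Aut G\<close> is the image of a homomorphism into the
  symmetric group on the classes, hence a subgroup; this is what makes \<open>induced_Aut G\<close>
  a group.\<close>

lemma group_hom_class_action: "group_hom (AutoGroup G) (induced_Aut G) (class_action G)"
proof -
  interpret B: group_hom "AutoGroup G" "BijGroup (pverts (reduced_gen_graph G))" "class_action G"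
    using AutoGroup group_BijGroup class_action_hom_BijGroup
    by (simp add: group_hom_def group_hom_axioms_def)
  have "induced_Aut G = BijGroup (pverts (reduced_gen_graph G))\<lparr>carrier := class_action G ` carrier (AutoGroup G)\<rparr>"
    by (simp add: induced_Aut_def class_action_def[abs_def])
  then have "group (induced_Aut G)"
    using subgroup.subgroup_is_group[OF B.img_is_subgroup B.H.group_axioms] by simp
  moreover have "class_action G \<in> hom (AutoGroup G) (induced_Aut G)"
    using B.homh by (auto simp: hom_def carrier_induced_Aut) (simp add: induced_Aut_def)
  ultimately show ?thesis
    using AutoGroup by (simp add: group_hom_def group_hom_axioms_def)
qed

lemma kernel_class_action:
  "kernel (AutoGroup G) (induced_Aut G) (class_action G) =
    {\<phi> \<in> auto G. \<forall>x \<in> carrier G. (x, \<phi> x) \<in> gen_equiv G}"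
proof -
  have "class_action G \<phi> = \<one>\<^bsub>induced_Aut G\<^esub> \<longleftrightarrow> (\<forall>x \<in> carrier G. (x, \<phi> x) \<in> gen_equiv G)"
    if \<phi>: "\<phi> \<in> auto G" for \<phi>
  proof -
    have "class_action G \<phi> = \<one>\<^bsub>induced_Aut G\<^esub> \<longleftrightarrow>
        (\<forall>C \<in> carrier G // gen_equiv G. class_action G \<phi> C = C)"
      by (auto simp: induced_Aut_def BijGroup_def fun_eq_iff class_action_def
          pverts_reduced_gen_graph)
    also have "\<dots> \<longleftrightarrow> (\<forall>x \<in> carrier G. class_action G \<phi> (gen_equiv G `` {x}) = gen_equiv G `` {x})"
      by (simp add: quotient_def)
    also have "\<dots> \<longleftrightarrow> (\<forall>x \<in> carrier G. (x, \<phi> x) \<in> gen_equiv G)"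
      using \<phi> eq_equiv_class_iff[OF equiv_gen_equiv]
      by (metis (no_types, lifting) auto_closed class_action_class)
    finally show ?thesis .
  qed
  then show ?thesis by (auto simp: kernel_def)
qed

end

section \<open>Groups of order $p^2$ and exponent $p$\<close>

text \<open>Order and exponent are what the counting of subgroups uses; coordinates enter only with
  the matrices.\<close>

locale elementary_abelian_rank2 = group G for G (structure) +
  fixes p :: nat
  assumes prime: "Factorial_Ring.prime p"
    and order_G: "order G = p\<^sup>2"
    and exponent: "x \<in> carrier G \<Longrightarrow> x [^] p = \<one>"
begin

lemma p_gt_1: "1 < p"
  using prime by (rule prime_gt_1_nat)

lemma finite_carrier: "finite (carrier G)"
  using order_G p_gt_1 by (simp add: order_gt_0_iff_finite[symmetric])

lemma generate_one_eq: "generate G {\<one>} = {\<one>}"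
  using generate_pow[OF one_closed] by auto

lemma card_generate:
  assumes "x \<in> carrier G" "x \<noteq> \<one>"
  shows "card (generate G {x}) = p"
proof -
  have "ord x dvd p"
    using assms exponent pow_eq_id by blast
  moreover have "ord x \<noteq> 1"
    using assms pow_ord_eq_1[OF assms(1)] by (metis nat_pow_eone)
  ultimately show ?thesis
    using prime prime_nat_iff generate_pow_card[OF assms(1)] by metis
qed

lemma finite_generate: "A \<subseteq> carrier G \<Longrightarrow> finite (generate G A)"
  using generate_incl finite_carrier finite_subset by metis

lemma card_generate_lt: "x \<in> carrier G \<Longrightarrow> card (generate G {x}) < order G"
  using card_generate[of x] generate_one_eq p_gt_1 less_1_mult[OF p_gt_1 p_gt_1]
  by (cases "x = \<one>") (auto simp: order_G power2_eq_square)

text \<open>A cyclic subgroup has at most p elements, so a generating pair cannot lie in one; this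
  excludes \<open>x = \<one>\<close> (both in the span of \<open>y\<close>) and \<open>y\<close> in
  the span of \<open>x\<close>. Conversely the generated subgroup properly contains one of order p,
  and by Lagrange its order is a power of p dividing p^2.\<close>

lemma generate_pair_eq:
  assumes "x \<in> carrier G" "y \<in> carrier G"
  shows "generate G {x, y} = carrier G \<longleftrightarrow> x \<noteq> \<one> \<and> y \<notin> generate G {x}"
proof
  assume gen: "generate G {x, y} = carrier G"
  have small: False if "{x, y} \<subseteq> generate G {w}" "w \<in> carrier G" for w
  proof -
    have "carrier G \<subseteq> generate G {w}"
      using generate_subgroup_incl[OF that(1) generate_is_subgroup[of "{w}"]] that(2) gen by simp
    then show False
      using card_mono[OF finite_generate[of "{w}"], of "carrier G"] card_generate_lt[OF that(2)] that(2)
      by (simp add: order_def)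
  qed
  then show "x \<noteq> \<one> \<and> y \<notin> generate G {x}"
    using small[of x] small[of y] assms generate.incl[of x "{x}" G] generate.incl[of y "{y}" G]
      generate.one[of G "{y}"] by auto
next
  assume *: "x \<noteq> \<one> \<and> y \<notin> generate G {x}"
  let ?H = "generate G {x, y}"
  have sub: "subgroup ?H G"
    using assms by (intro generate_is_subgroup) simp
  have "generate G {x} \<subset> ?H"
    using * mono_generate[of "{x}" "{x, y}"] generate.incl[of y "{x, y}" G] by blast
  then have "p < card ?H"
    using psubset_card_mono[OF finite_generate[of "{x, y}"], of "generate G {x}"]
      card_generate[of x] assms * by simp
  moreover have "card ?H dvd p\<^sup>2"
    using lagrange[OF sub] by (metis dvd_triv_right order_G)
  then obtain i where "i \<le> 2" "card ?H = p ^ i"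
    using prime by (auto simp: divides_primepow_nat)
  ultimately have "card ?H = p\<^sup>2"
    using p_gt_1 by (cases "i = 2") (auto simp: le_Suc_eq numeral_2_eq_2)
  then show "?H = carrier G"
    using card_subset_eq[OF finite_carrier subgroup.subset[OF sub]] order_G by (simp add: order_def)
qed

lemma neighbours_gen_graph:
  "x \<in> carrier G \<Longrightarrow>
    neighbours (gen_graph G) x = (if x = \<one> then {} else carrier G - generate G {x})"
  by (auto simp: neighbours_def parcs_gen_graph generate_pair_eq cong: conj_cong)

text \<open>For \<open>x \<noteq> \<one>\<close> the neighbours form the complement of the span of
  \<open>x\<close>. It determines the span, and it is nonempty, which separates \<open>x\<close>
  from the identity with its empty neighbourhood.\<close>

lemma gen_equiv_iff:
  assumes "x \<in> carrier G" "y \<in> carrier G"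
  shows "(x, y) \<in> gen_equiv G \<longleftrightarrow> generate G {x} = generate G {y}"
proof -
  have ne: "carrier G - generate G {w} \<noteq> {}" if "w \<in> carrier G" for w
    using card_generate_lt[OF that] card_mono[OF finite_generate[of "{w}"], of "carrier G"] that
    by (auto simp: order_def)
  have one: "generate G {w} = {\<one>} \<longleftrightarrow> w = \<one>" if "w \<in> carrier G" for w
    using generate.incl[of w "{w}" G] generate_one_eq by auto
  have "carrier G - generate G {x} = carrier G - generate G {y} \<longleftrightarrow> generate G {x} = generate G {y}"
    using generate_incl[of "{x}"] generate_incl[of "{y}"] assms by blast
  then show ?thesis
    using ne[OF assms(1)] ne[OF assms(2)] one[OF assms(1)] one[OF assms(2)] assms
    by (auto simp: gen_equiv_def neighbours_gen_graph generate_one_eq)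
qed

abbreviation cls :: "'a \<Rightarrow> 'a set" where
  "cls x \<equiv> gen_equiv G `` {x}"

text \<open>Both spans have p elements, so an inclusion between them is an equality.\<close>

lemma generate_eq_iff_mem:
  assumes "x \<in> carrier G" "y \<in> carrier G" "x \<noteq> \<one>" "y \<noteq> \<one>"
  shows "generate G {x} = generate G {y} \<longleftrightarrow> y \<in> generate G {x}"
proof
  assume y: "y \<in> generate G {x}"
  have "generate G {y} \<subseteq> generate G {x}"
    using generate_subgroup_incl[of "{y}"] generate_is_subgroup[of "{x}"] y assms by simp
  then show "generate G {x} = generate G {y}"
    using card_subset_eq[OF finite_generate[of "{x}"], of "generate G {y}"] card_generate assms by simp
qed (use generate.incl[of y "{y}" G] in simp)

lemma gen_equiv_iff_mem:
  assumes "x \<in> carrier G" "y \<in> carrier G" "x \<noteq> \<one>"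
  shows "(x, y) \<in> gen_equiv G \<longleftrightarrow> y \<in> generate G {x} \<and> y \<noteq> \<one>"
proof (cases "y = \<one>")
  case True
  have "generate G {x} \<noteq> {\<one>}"
    using card_generate[OF assms(1,3)] p_gt_1 by auto
  then show ?thesis
    using True assms by (simp add: gen_equiv_iff generate_one_eq)
next
  case False
  then show ?thesis
    using generate_eq_iff_mem[OF assms] assms by (simp add: gen_equiv_iff)
qed

lemma cls_one: "cls \<one> = {\<one>}"
proof -
  have "(\<one>, x) \<in> gen_equiv G \<longleftrightarrow> x = \<one>" if "x \<in> carrier G" for x
    using gen_equiv_iff[OF one_closed that] generate.incl[of x "{x}" G] by (auto simp: generate_one_eq)
  moreover have "x \<in> carrier G" if "(\<one>, x) \<in> gen_equiv G" for x
    using that by (simp add: gen_equiv_def)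
  ultimately show ?thesis by blast
qed

lemma cls_eq:
  assumes "x \<in> carrier G" "x \<noteq> \<one>"
  shows "cls x = generate G {x} - {\<one>}"
proof -
  have "y \<in> carrier G" if "y \<in> generate G {x} \<or> (x, y) \<in> gen_equiv G" for y
    using that generate_incl[of "{x}"] assms by (auto simp: gen_equiv_def)
  then show ?thesis
    using gen_equiv_iff_mem[OF assms(1) _ assms(2)] unfolding set_eq_iff Image_singleton_iff by blast
qed

lemma card_cls: "x \<in> carrier G \<Longrightarrow> x \<noteq> \<one> \<Longrightarrow> card (cls x) = p - 1"
  by (simp add: cls_eq card_generate generate.one)

definition nontrivial_classes :: "'a set set" where
  "nontrivial_classes = carrier G // gen_equiv G - {{\<one>}}"

lemma nontrivial_classes_iff:
  "C \<in> nontrivial_classes \<longleftrightarrow> (\<exists>x \<in> carrier G. x \<noteq> \<one> \<and> C = cls x)"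
proof
  assume C: "C \<in> nontrivial_classes"
  then obtain x where "x \<in> carrier G" "C = cls x"
    unfolding nontrivial_classes_def by (blast elim: quotientE)
  moreover from this have "x \<noteq> \<one>"
    using C cls_one by (auto simp: nontrivial_classes_def)
  ultimately show "\<exists>x \<in> carrier G. x \<noteq> \<one> \<and> C = cls x"
    by blast
next
  assume "\<exists>x \<in> carrier G. x \<noteq> \<one> \<and> C = cls x"
  then obtain x where x: "x \<in> carrier G" "x \<noteq> \<one>" "C = cls x" by blast
  then have "C \<noteq> {\<one>}" by (auto simp: cls_eq)
  then show "C \<in> nontrivial_classes"
    using x by (simp add: nontrivial_classes_def quotientI)
qed

lemma pverts_reduced: "pverts (reduced_gen_graph G) = insert {\<one>} nontrivial_classes"
  using quotientI[OF one_closed, of "gen_equiv G"] cls_one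
  by (auto simp: pverts_reduced_gen_graph nontrivial_classes_def)

lemma Union_nontrivial_classes: "\<Union>nontrivial_classes = carrier G - {\<one>}"
proof -
  have "x \<in> cls x" if "x \<in> carrier G" for x
    using equiv_class_self[OF equiv_gen_equiv that] .
  moreover have "cls x \<subseteq> carrier G - {\<one>}" if "x \<in> carrier G" "x \<noteq> \<one>" for x
    using generate_incl[of "{x}"] that by (auto simp: cls_eq)
  ultimately show ?thesis
    unfolding set_eq_iff Union_iff Bex_def nontrivial_classes_iff by blast
qed

lemma nontrivial_classes_disjoint:
  "C \<in> nontrivial_classes \<Longrightarrow> D \<in> nontrivial_classes \<Longrightarrow> C \<noteq> D \<Longrightarrow> C \<inter> D = {}"
  using quotient_disj[OF equiv_gen_equiv] by (auto simp: nontrivial_classes_def)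

lemma card_mem_nontrivial_classes: "C \<in> nontrivial_classes \<Longrightarrow> finite C \<and> card C = p - 1"
  using finite_carrier Union_nontrivial_classes finite_subset[of C "carrier G"]
  by (metis Diff_subset Union_upper card_cls nontrivial_classes_iff subset_trans)

lemma finite_nontrivial_classes: "finite nontrivial_classes"
  using finite_carrier Union_nontrivial_classes by (metis finite_Diff finite_UnionD)

text \<open>The classes split the p^2 - 1 nontrivial elements into sets of size p - 1, and the
  positive factor p - 1 cancels from (p - 1)(p + 1).\<close>

lemma card_nontrivial_classes: "card nontrivial_classes = p + 1"
proof -
  have "(p - 1) * card nontrivial_classes = card (carrier G - {\<one>})"
    using card_partition[of nontrivial_classes "p - 1"] finite_carrier finite_nontrivial_classes
      card_mem_nontrivial_classes nontrivial_classes_disjoint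
    by (simp add: Union_nontrivial_classes)
  also have "\<dots> = p\<^sup>2 - 1"
    using order_G by (simp add: order_def)
  also have "\<dots> = (p - 1) * (p + 1)"
    by (simp add: algebra_simps power2_eq_square)
  finally show ?thesis
    unfolding mult_cancel1 using p_gt_1 by simp
qed

lemma card_pverts_reduced: "card (pverts (reduced_gen_graph G)) = p + 2"
proof -
  have "{\<one>} \<notin> nontrivial_classes" by (simp add: nontrivial_classes_def)
  then show ?thesis
    unfolding pverts_reduced using finite_nontrivial_classes card_nontrivial_classes by simp
qed

section \<open>The multipartite structure of both graphs\<close>

lemma arc_iff_cls:
  assumes "x \<in> carrier G" "y \<in> carrier G"
  shows "(x, y) \<in> parcs (gen_graph G) \<longleftrightarrow> x \<noteq> \<one> \<and> y \<noteq> \<one> \<and> cls x \<noteq> cls y"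
proof -
  have "cls x = cls y \<longleftrightarrow> (x, y) \<in> gen_equiv G"
    using eq_equiv_class_iff[OF equiv_gen_equiv assms] .
  moreover have "\<one> \<in> generate G {x}"
    by (rule generate.one)
  ultimately show ?thesis
    using gen_equiv_iff_mem[OF assms] assms by (auto simp: parcs_gen_graph generate_pair_eq)
qed

lemma cls_unique:
  assumes "C \<in> carrier G // gen_equiv G" "x \<in> C"
  shows "C = cls x"
proof -
  obtain y where "C = cls y"
    using assms(1) by (rule quotientE)
  then show ?thesis
    using assms(2) equiv_class_eq[OF equiv_gen_equiv, of y x] by simp
qed

text \<open>Arcs between classes are defined through some pair of members. By
  \<open>arc_iff_cls\<close> adjacency of members depends only on their classes, so any
  representatives will do.\<close>

lemma arc_reduced_iff:
  "(C, D) \<in> parcs (reduced_gen_graph G) \<longleftrightarrow>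
    C \<in> nontrivial_classes \<and> D \<in> nontrivial_classes \<and> C \<noteq> D"
proof -
  have self: "x \<in> cls x" if "x \<in> carrier G" for x
    using equiv_class_self[OF equiv_gen_equiv that] .
  have "(C, D) \<in> parcs (reduced_gen_graph G) \<longleftrightarrow>
      (\<exists>x \<in> carrier G. \<exists>y \<in> carrier G. C = cls x \<and> D = cls y \<and> (x, y) \<in> parcs (gen_graph G))"
  proof
    assume "(C, D) \<in> parcs (reduced_gen_graph G)"
    then obtain x y where "C \<in> carrier G // gen_equiv G" "D \<in> carrier G // gen_equiv G"
      and xy: "x \<in> C" "y \<in> D" "(x, y) \<in> parcs (gen_graph G)"
      unfolding parcs_reduced_gen_graph by (elim conjE bexE)
    then have "C = cls x" "D = cls y"
      using cls_unique by simp_all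
    moreover have "x \<in> carrier G" "y \<in> carrier G"
      using xy(3) by (simp_all add: parcs_gen_graph)
    ultimately show "\<exists>x \<in> carrier G. \<exists>y \<in> carrier G. C = cls x \<and> D = cls y \<and> (x, y) \<in> parcs (gen_graph G)"
      using xy(3) by (intro bexI conjI)
  next
    assume "\<exists>x \<in> carrier G. \<exists>y \<in> carrier G. C = cls x \<and> D = cls y \<and> (x, y) \<in> parcs (gen_graph G)"
    then obtain x y where "x \<in> carrier G" "y \<in> carrier G" "C = cls x" "D = cls y"
      "(x, y) \<in> parcs (gen_graph G)" by blast
    moreover from this have "x \<in> C" "y \<in> D" using self by simp_all
    ultimately show "(C, D) \<in> parcs (reduced_gen_graph G)"
      unfolding parcs_reduced_gen_graph using quotientI[of _ "carrier G" "gen_equiv G"] by blast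
  qed
  also have "\<dots> \<longleftrightarrow> C \<in> nontrivial_classes \<and> D \<in> nontrivial_classes \<and> C \<noteq> D"
    using arc_iff_cls unfolding nontrivial_classes_iff by (metis (no_types, lifting))
  finally show ?thesis .
qed

lemma multipartite_gen_graph:
  obtains \<beta> where "multipartite_with_isolated (gen_graph G) \<one> \<beta> (p + 1) (p - 1)"
proof -
  obtain \<kappa> \<beta> where \<kappa>: "bij_betw \<kappa> {1..p + 1} nontrivial_classes"
    and \<beta>: "bij_betw \<beta> ({1..p + 1} \<times> {1..p - 1}) (\<Union>nontrivial_classes)"
    and mem: "\<And>i a. i \<in> {1..p + 1} \<Longrightarrow> a \<in> {1..p - 1} \<Longrightarrow> \<beta> (i, a) \<in> \<kappa> i"
    using partition_indexing[OF finite_nontrivial_classes card_nontrivial_classes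
        card_mem_nontrivial_classes nontrivial_classes_disjoint] by blast
  have \<beta>_in: "\<beta> (i, a) \<in> carrier G" "\<beta> (i, a) \<noteq> \<one>" "cls (\<beta> (i, a)) = \<kappa> i"
    if "i \<in> {1..p + 1}" "a \<in> {1..p - 1}" for i a
  proof -
    show "\<beta> (i, a) \<in> carrier G" "\<beta> (i, a) \<noteq> \<one>"
      using bij_betwE[OF \<beta>] that by (auto simp: Union_nontrivial_classes)
    have "\<kappa> i \<in> carrier G // gen_equiv G"
      using bij_betwE[OF \<kappa>] that by (auto simp: nontrivial_classes_def)
    then show "cls (\<beta> (i, a)) = \<kappa> i"
      using mem[OF that] cls_unique by simp
  qed
  have "multipartite_with_isolated (gen_graph G) \<one> \<beta> (p + 1) (p - 1)"
  proof
    show "2 \<le> p + 1" "1 \<le> p - 1" using p_gt_1 by auto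
    show "\<one> \<in> pverts (gen_graph G)" by simp
    show "bij_betw \<beta> ({1..p + 1} \<times> {1..p - 1}) (pverts (gen_graph G) - {\<one>})"
      using \<beta> by (simp add: Union_nontrivial_classes)
    show "(\<one>, y) \<notin> parcs (gen_graph G)" "(y, \<one>) \<notin> parcs (gen_graph G)" for y
      using generate.one[of G "{y}"]
      by (auto simp: parcs_gen_graph generate_pair_eq)
    show "(\<beta> (i, a), \<beta> (j, b)) \<in> parcs (gen_graph G) \<longleftrightarrow> i \<noteq> j"
      if i: "i \<in> {1..p + 1}" "a \<in> {1..p - 1}" "j \<in> {1..p + 1}" "b \<in> {1..p - 1}" for i a j b
    proof -
      have "\<kappa> i = \<kappa> j \<longleftrightarrow> i = j"
        using bij_betw_imp_inj_on[OF \<kappa>] i by (simp add: inj_on_eq_iff)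
      then show ?thesis
        using \<beta>_in[OF i(1,2)] \<beta>_in[OF i(3,4)] by (simp add: arc_iff_cls)
    qed
  qed
  with that show ?thesis .
qed

text \<open>Each nontrivial class is a part with one vertex, so the second component of a label only
  takes the value 1.\<close>

lemma multipartite_reduced_gen_graph:
  obtains \<beta> where "multipartite_with_isolated (reduced_gen_graph G) {\<one>} \<beta> (p + 1) 1"
proof -
  obtain \<kappa> where \<kappa>: "bij_betw \<kappa> {1..p + 1} nontrivial_classes"
    using ex_bij_betw_nat_finite_1[OF finite_nontrivial_classes] card_nontrivial_classes by auto
  have "multipartite_with_isolated (reduced_gen_graph G) {\<one>} (\<lambda>(i, a). \<kappa> i) (p + 1) 1"
  proof
    show "2 \<le> p + 1" using p_gt_1 by auto
    have "inj_on (\<lambda>(i, a). \<kappa> i) ({1..p + 1} \<times> {1..1::nat})"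
      using bij_betw_imp_inj_on[OF \<kappa>] by (auto simp: inj_on_def)
    moreover have "(\<lambda>(i, a). \<kappa> i) ` ({1..p + 1} \<times> {1..1::nat}) = \<kappa> ` {1..p + 1}"
      by (auto simp: image_iff)
    ultimately show "bij_betw (\<lambda>(i, a). \<kappa> i) ({1..p + 1} \<times> {1..1::nat}) (pverts (reduced_gen_graph G) - {{\<one>}})"
      using bij_betw_imp_surj_on[OF \<kappa>] by (simp add: bij_betw_def pverts_reduced nontrivial_classes_def)
    show "((\<lambda>(i, a). \<kappa> i) (i, a), (\<lambda>(i, a). \<kappa> i) (j, b)) \<in> parcs (reduced_gen_graph G) \<longleftrightarrow> i \<noteq> j"
      if "i \<in> {1..p + 1}" "j \<in> {1..p + 1}" for i j and a b :: nat
      using bij_betw_imp_inj_on[OF \<kappa>] bij_betwE[OF \<kappa>] that by (simp add: arc_reduced_iff inj_on_eq_iff)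
    show "({\<one>}, C) \<notin> parcs (reduced_gen_graph G)" "(C, {\<one>}) \<notin> parcs (reduced_gen_graph G)" for C
      by (simp_all add: arc_reduced_iff nontrivial_classes_def)
  qed (simp_all add: pverts_reduced)
  with that show ?thesis .
qed

text \<open>An automorphism fixes the vertex \<open>{\<one>}\<close>, so by injectivity it permutes
  the others, and these all have weight p - 1.\<close>

lemma weighted_graph_Aut_eq:
  "weighted_graph_Aut (weighted_reduced_gen_graph G) = graph_Aut (reduced_gen_graph G)"
proof -
  let ?\<Gamma> = "reduced_gen_graph G" and ?w = "weighted_reduced_gen_graph G"
  have sel: "pverts ?w = pverts ?\<Gamma>" "parcs ?w = parcs ?\<Gamma>" "weight ?w = card"
    by (simp_all add: weighted_reduced_gen_graph_def pair_pre_digraph.defs)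
  obtain \<beta> where "multipartite_with_isolated ?\<Gamma> {\<one>} \<beta> (p + 1) 1"
    by (rule multipartite_reduced_gen_graph)
  then interpret multipartite_with_isolated ?\<Gamma> "{\<one>}" \<beta> "p + 1" 1 .
  have "card (f C) = card C" if f: "f \<in> graph_auts ?\<Gamma>" and C: "C \<in> pverts ?\<Gamma>" for f C
  proof (cases "C = {\<one>}")
    case True
    then show ?thesis by (simp add: graph_aut_fixes[OF f])
  next
    case False
    then have "f C \<noteq> f {\<one>}"
      using graph_autsD(2)[OF f] C z by (auto simp: bij_betw_def dest: inj_onD)
    then show ?thesis
      using False C graph_autsD(3)[OF f C] card_mem_nontrivial_classes
      by (simp add: graph_aut_fixes[OF f] pverts_reduced)
  qed
  then have "weighted_graph_auts ?w = graph_auts ?\<Gamma>"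
    unfolding weighted_graph_auts_def graph_auts_def sel by auto
  then show ?thesis
    by (simp add: weighted_graph_Aut_def graph_Aut_def sel)
qed

end

section \<open>Automorphisms as matrices\<close>

lemma sum_less_2: "(\<Sum>k<2::nat. g k) = g 0 + (g 1 :: int)"
  by (simp add: numeral_2_eq_2)

text \<open>Fixing \<open>f\<close> amounts to choosing a basis. Coordinates are integers in
  \<open>{0..<int p}\<close>, the form that the entries of matrices over
  \<open>residue_ring (int p)\<close> also have.\<close>

locale rank2_coordinates = group G for G (structure) +
  fixes p :: nat and f :: "'a \<Rightarrow> int \<times> int"
  assumes prime: "Factorial_Ring.prime p"
    and f: "f \<in> iso G (integer_mod_group p \<times>\<times> integer_mod_group p)"
begin

lemma p_gt_1: "1 < p"
  using prime by (rule prime_gt_1_nat)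

definition coord :: "nat \<Rightarrow> 'a \<Rightarrow> int" where
  "coord i x = (if i = 0 then fst (f x) else snd (f x))"

lemma f_bij: "bij_betw f (carrier G) ({0..<int p} \<times> {0..<int p})"
  using f p_gt_1 by (simp add: iso_def carrier_integer_mod_group)

lemma coord_hom: "coord i \<in> hom G (integer_mod_group p)"
proof (rule homI)
  fix x y assume xy: "x \<in> carrier G" "y \<in> carrier G"
  show "coord i (x \<otimes> y) = coord i x \<otimes>\<^bsub>integer_mod_group p\<^esub> coord i y"
    using hom_mult[OF iso_imp_homomorphism[OF f] xy] by (simp add: coord_def mult_DirProd')
next
  fix x assume "x \<in> carrier G"
  then show "coord i x \<in> carrier (integer_mod_group p)"
    using bij_betwE[OF f_bij] p_gt_1 by (auto simp: coord_def carrier_integer_mod_group mem_Times_iff)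
qed

lemma coord_mult:
  "x \<in> carrier G \<Longrightarrow> y \<in> carrier G \<Longrightarrow> coord i (x \<otimes> y) = (coord i x + coord i y) mod int p"
  using hom_mult[OF coord_hom] by simp

lemma coord_range: "x \<in> carrier G \<Longrightarrow> coord i x \<in> {0..<int p}"
  using hom_in_carrier[OF coord_hom, of x i] p_gt_1 by (simp add: carrier_integer_mod_group)

lemma coord_mod: "x \<in> carrier G \<Longrightarrow> coord i x mod int p = coord i x"
  using coord_range[of x i] by simp

lemma coord_pow:
  assumes "x \<in> carrier G"
  shows "coord i (x [^] (n::nat)) = (int n * coord i x) mod int p"
proof -
  interpret group_hom G "integer_mod_group p" "coord i"
    using coord_hom group_axioms by (simp add: group_hom_def group_hom_axioms_def)
  show ?thesis using hom_nat_pow[OF assms, of n] by simp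
qed

lemma coord_eqI:
  assumes "x \<in> carrier G" "y \<in> carrier G" "\<And>i. i < 2 \<Longrightarrow> coord i x = coord i y"
  shows "x = y"
proof -
  have "f x = f y"
    using assms(3)[of 0] assms(3)[of 1] by (simp add: coord_def prod_eq_iff)
  then show ?thesis
    using bij_betw_imp_inj_on[OF f_bij] assms(1,2) by (simp add: inj_on_eq_iff)
qed

text \<open>Arbitrary integers are accepted and reduced modulo p here, so unreduced sums of products
  may serve as coordinates.\<close>

definition of_coord :: "(nat \<Rightarrow> int) \<Rightarrow> 'a" where
  "of_coord a = inv_into (carrier G) f (a 0 mod int p, a 1 mod int p)"

lemma of_coord_in: "of_coord a \<in> carrier G"
  and coord_of_coord: "i < 2 \<Longrightarrow> coord i (of_coord a) = a i mod int p"
proof -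
  have *: "(a 0 mod int p, a 1 mod int p) \<in> f ` carrier G"
    using p_gt_1 bij_betw_imp_surj_on[OF f_bij] by simp
  show "of_coord a \<in> carrier G"
    unfolding of_coord_def by (rule inv_into_into[OF *])
  show "coord i (of_coord a) = a i mod int p" if "i < 2"
    using f_inv_into_f[OF *] that by (auto simp: coord_def of_coord_def less_2_cases_iff)
qed

text \<open>The order is counted through the bijection \<open>f\<close>; the exponent is p because
  the coordinates of a p-th power are multiples of p, reduced to 0.\<close>

sublocale elementary_abelian_rank2 G p
proof
  show "order G = p\<^sup>2"
    using bij_betw_same_card[OF f_bij] by (simp add: order_def card_cartesian_product power2_eq_square)
  show "x [^] p = \<one>" if "x \<in> carrier G" for x
  proof (rule coord_eqI)
    have "coord i \<one> = 0" for i
      using coord_pow[OF one_closed, of i 0] by simp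
    then show "coord i (x [^] p) = coord i \<one>" for i
      using that by (simp add: coord_pow)
  qed (use that in auto)
qed (rule prime)

definition basis :: "nat \<Rightarrow> 'a" where
  "basis k = of_coord (\<lambda>i. if i = k then 1 else 0)"

lemma basis_in: "basis k \<in> carrier G"
  by (simp add: basis_def of_coord_in)

lemma coord_basis: "i < 2 \<Longrightarrow> coord i (basis k) = (if i = k then 1 else 0)"
  using p_gt_1 by (simp add: basis_def coord_of_coord)

text \<open>Every element is a product of powers of the two basis elements with its coordinates as
  exponents, so a homomorphism acts on coordinates as a matrix on a column vector.\<close>

lemma hom_coord:
  assumes \<phi>: "\<phi> \<in> hom G G" and x: "x \<in> carrier G"
  shows "coord i (\<phi> x) = (\<Sum>k<2. coord i (\<phi> (basis k)) * coord k x) mod int p"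
proof -
  interpret group_hom G G \<phi>
    using \<phi> by unfold_locales
  \<comment> \<open>Coordinates are nonnegative, so \<open>nat\<close> turns them into exponents
    without loss.\<close>
  define a where "a k = nat (coord k x)" for k
  have a: "int (a k) = coord k x" for k
    using coord_range[OF x, of k] by (simp add: a_def)
  have "x = basis 0 [^] a 0 \<otimes> basis 1 [^] a 1"
  proof (rule coord_eqI)
    show "coord j x = coord j (basis 0 [^] a 0 \<otimes> basis 1 [^] a 1)" if "j < 2" for j
      using that coord_mod[OF x]
      by (auto simp: coord_mult coord_pow basis_in a coord_basis less_2_cases_iff)
  qed (use x basis_in in auto)
  then have "\<phi> x = \<phi> (basis 0) [^] a 0 \<otimes> \<phi> (basis 1) [^] a 1"
    using hom_mult[of "basis 0 [^] a 0" "basis 1 [^] a 1"] by (simp add: basis_in hom_nat_pow)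
  then show ?thesis
    by (simp add: coord_mult coord_pow basis_in a sum_less_2 mod_add_eq mult.commute)
qed

section \<open>Endomorphisms and matrices modulo p\<close>

abbreviation "M \<equiv> matrix_monoid 2 (residue_ring (int p))"

lemma carrier_M: "carrier M = {..<2} \<rightarrow>\<^sub>E {..<2} \<rightarrow>\<^sub>E {0..<int p}"
  by (simp add: matrix_monoid_def residue_ring_def) (metis atLeastLessThanPlusOne_atLeastAtMost_int diff_add_cancel)

lemma M_entry:
  assumes "A \<in> carrier M" "i < 2" "j < 2"
  shows "A i j \<in> {0..<int p}"
proof -
  have "A i \<in> {..<2} \<rightarrow>\<^sub>E {0..<int p}"
    using PiE_mem[of A "{..<2}" "\<lambda>_. {..<2} \<rightarrow>\<^sub>E {0..<int p}" i] assms by (simp add: carrier_M)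
  then show ?thesis
    using PiE_mem[of "A i" "{..<2}" "\<lambda>_. {0..<int p}" j] assms by simp
qed

text \<open>The ring operations reduce modulo p at every step; one reduction at the end gives the
  same residue, which is the shape of \<open>hom_coord\<close>.\<close>

lemma mult_M_entry:
  assumes A: "A \<in> carrier M" and B: "B \<in> carrier M"
  shows "A \<otimes>\<^bsub>M\<^esub> B = (\<lambda>i \<in> {..<2}. \<lambda>j \<in> {..<2}. (\<Sum>k<2. A i k * B k j) mod int p)"
proof -
  interpret residues "int p" "residue_ring (int p)"
    using p_gt_1 by unfold_locales simp_all
  have "(\<Oplus>\<^bsub>residue_ring (int p)\<^esub>k \<in> {..<2}. A i k \<otimes>\<^bsub>residue_ring (int p)\<^esub> B k j)
      = (\<Sum>k<2. A i k * B k j) mod int p" for i j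
  proof -
    have "(\<Oplus>\<^bsub>residue_ring (int p)\<^esub>k \<in> {..<2}. A i k \<otimes>\<^bsub>residue_ring (int p)\<^esub> B k j)
        = (\<Oplus>\<^bsub>residue_ring (int p)\<^esub>k \<in> {0, 1}. A i k \<otimes>\<^bsub>residue_ring (int p)\<^esub> B k j)"
      by (simp add: numeral_2_eq_2 lessThan_Suc insert_commute)
    also have "\<dots> = (A i 0 * B 0 j + A i 1 * B 1 j) mod int p"
      using p_gt_1 by (simp add: res_carrier_eq res_mult_eq res_add_eq res_zero_eq mod_add_eq)
    finally show ?thesis by (simp add: sum_less_2)
  qed
  then show ?thesis by (simp add: matrix_monoid_def)
qed

lemma residue_ring_simps:
  "carrier (residue_ring (int p)) = {0..<int p}"
  "\<zero>\<^bsub>residue_ring (int p)\<^esub> = 0" "\<one>\<^bsub>residue_ring (int p)\<^esub> = 1"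
  by (auto simp: residue_ring_def)

lemma one_M: "\<one>\<^bsub>M\<^esub> = (\<lambda>i \<in> {..<2}. \<lambda>j \<in> {..<2}. if i = j then 1 else 0)"
  unfolding matrix_monoid_def residue_ring_simps by simp

text \<open>Extensionality makes a map determined by its values on the group, as for the elements of
  \<open>auto G\<close>; otherwise \<open>mat\<close> would not be injective.\<close>

definition endos :: "('a \<Rightarrow> 'a) set" where
  "endos = hom G G \<inter> extensional (carrier G)"

text \<open>Column \<open>j\<close> holds the coordinates of the image of \<open>basis j\<close>, so
  composition becomes the matrix product in the same order.\<close>

definition mat :: "('a \<Rightarrow> 'a) \<Rightarrow> nat \<Rightarrow> nat \<Rightarrow> int" where
  "mat \<phi> = (\<lambda>i \<in> {..<2}. \<lambda>j \<in> {..<2}. coord i (\<phi> (basis j)))"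

lemma endos_closed: "\<phi> \<in> endos \<Longrightarrow> x \<in> carrier G \<Longrightarrow> \<phi> x \<in> carrier G"
  by (auto simp: endos_def hom_def)

lemma auto_subset_endos: "auto G \<subseteq> endos"
  by (auto simp: auto_def endos_def Bij_def)

lemma endos_compose: "\<phi> \<in> endos \<Longrightarrow> \<psi> \<in> endos \<Longrightarrow> compose (carrier G) \<phi> \<psi> \<in> endos"
  by (auto simp: endos_def hom_def compose_def Pi_iff)

lemma id_endos: "(\<lambda>x \<in> carrier G. x) \<in> endos"
  by (simp add: endos_def hom_def)

lemma mat_in: "\<phi> \<in> endos \<Longrightarrow> mat \<phi> \<in> carrier M"
  using coord_range endos_closed basis_in by (auto simp: carrier_M mat_def)

lemma mat_compose:
  assumes "\<phi> \<in> endos" "\<psi> \<in> endos"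
  shows "mat (compose (carrier G) \<phi> \<psi>) = mat \<phi> \<otimes>\<^bsub>M\<^esub> mat \<psi>"
proof -
  have "coord i (\<phi> (\<psi> (basis j))) = (\<Sum>k<2. coord i (\<phi> (basis k)) * coord k (\<psi> (basis j))) mod int p" for i j
    using assms(1) by (intro hom_coord endos_closed[OF assms(2)] basis_in) (simp add: endos_def)
  then show ?thesis
    unfolding mult_M_entry[OF mat_in[OF assms(1)] mat_in[OF assms(2)]]
    by (auto simp: mat_def compose_eq basis_in intro!: restrict_ext)
qed

lemma mat_id: "mat (\<lambda>x \<in> carrier G. x) = \<one>\<^bsub>M\<^esub>"
  by (auto simp: one_M mat_def basis_in coord_basis intro!: restrict_ext)

lemma mat_inj: "inj_on mat endos"
proof (rule inj_onI)
  fix \<phi> \<psi> assume \<phi>: "\<phi> \<in> endos" and \<psi>: "\<psi> \<in> endos" and eq: "mat \<phi> = mat \<psi>"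
  have entries: "coord i (\<phi> (basis k)) = coord i (\<psi> (basis k))" if "i < 2" "k < 2" for i k
    using fun_cong[OF fun_cong[OF eq], of i k] that by (simp add: mat_def)
  show "\<phi> = \<psi>"
  proof (rule extensionalityI[of _ "carrier G"])
    fix x assume x: "x \<in> carrier G"
    show "\<phi> x = \<psi> x"
    proof (rule coord_eqI)
      show "coord i (\<phi> x) = coord i (\<psi> x)" if "i < 2" for i
        using \<phi> \<psi> x entries[OF that] by (simp add: hom_coord endos_def)
    qed (use \<phi> \<psi> x endos_closed in auto)
  qed (use \<phi> \<psi> in \<open>auto simp: endos_def\<close>)
qed

text \<open>The witness multiplies the coordinate column by \<open>A\<close>. It is additive because
  reducing coordinates modulo p before or after multiplying by an entry of \<open>A\<close> gives
  the same residue.\<close>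

lemma mat_surj:
  assumes A: "A \<in> carrier M"
  shows "\<exists>\<phi> \<in> endos. mat \<phi> = A"
proof
  let ?\<phi> = "\<lambda>x \<in> carrier G. of_coord (\<lambda>i. \<Sum>k<2. A i k * coord k x)"
  have "?\<phi> \<in> hom G G"
  proof (rule homI)
    fix x y assume xy: "x \<in> carrier G" "y \<in> carrier G"
    show "?\<phi> (x \<otimes> y) = ?\<phi> x \<otimes> ?\<phi> y"
    proof (rule coord_eqI)
      fix i :: nat assume i: "i < 2"
      have "(A i 0 * ((coord 0 x + coord 0 y) mod int p) + A i 1 * ((coord 1 x + coord 1 y) mod int p)) mod int p
          = (A i 0 * (coord 0 x + coord 0 y) + A i 1 * (coord 1 x + coord 1 y)) mod int p"
        by (intro mod_add_cong mod_mult_right_eq)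
      then show "coord i (?\<phi> (x \<otimes> y)) = coord i (?\<phi> x \<otimes> ?\<phi> y)"
        using xy i by (simp add: coord_mult of_coord_in coord_of_coord sum_less_2 mod_add_eq algebra_simps)
    qed (use xy of_coord_in in auto)
  qed (simp add: of_coord_in)
  then show "?\<phi> \<in> endos" by (simp add: endos_def)
  show "mat ?\<phi> = A"
  proof (rule PiE_ext)
    show mem: "mat ?\<phi> \<in> {..<2} \<rightarrow>\<^sub>E {..<2} \<rightarrow>\<^sub>E {0..<int p}" "A \<in> {..<2} \<rightarrow>\<^sub>E {..<2} \<rightarrow>\<^sub>E {0..<int p}"
      using mat_in[OF \<open>?\<phi> \<in> endos\<close>] A by (simp_all add: carrier_M)
    fix i :: nat assume i: "i \<in> {..<2}"
    show "mat ?\<phi> i = A i"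
    proof (rule PiE_ext)
      show "mat ?\<phi> i \<in> {..<2} \<rightarrow>\<^sub>E {0..<int p}" "A i \<in> {..<2} \<rightarrow>\<^sub>E {0..<int p}"
        using mem[THEN PiE_mem, OF i] by simp_all
      fix j :: nat assume j: "j \<in> {..<2}"
      then show "mat ?\<phi> i j = A i j"
        using i M_entry[OF A, of i j]
        by (auto simp: mat_def basis_in coord_of_coord sum_less_2 coord_basis less_2_cases_iff)
    qed
  qed
qed

text \<open>Every matrix is \<open>mat\<close> of an endomorphism and \<open>mat\<close> respects
  products, so the laws follow from those of composition.\<close>

lemma monoid_M: "monoid M"
proof (rule monoidI)
  show "\<one>\<^bsub>M\<^esub> \<in> carrier M"
    using mat_in[OF id_endos] by (simp add: mat_id)
  fix A B C assume "A \<in> carrier M" "B \<in> carrier M"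
  then obtain \<phi> \<psi> where *: "\<phi> \<in> endos" "\<psi> \<in> endos" "A = mat \<phi>" "B = mat \<psi>"
    using mat_surj by metis
  then show "A \<otimes>\<^bsub>M\<^esub> B \<in> carrier M"
    using mat_in[OF endos_compose] by (simp add: mat_compose)
  have "compose (carrier G) (\<lambda>x \<in> carrier G. x) \<phi> = \<phi>" "compose (carrier G) \<phi> (\<lambda>x \<in> carrier G. x) = \<phi>"
    using * by (auto simp: endos_def hom_def)
  then show "\<one>\<^bsub>M\<^esub> \<otimes>\<^bsub>M\<^esub> A = A" "A \<otimes>\<^bsub>M\<^esub> \<one>\<^bsub>M\<^esub> = A"
    using * mat_compose[OF id_endos *(1)] mat_compose[OF *(1) id_endos] by (simp_all add: mat_id)
  assume "C \<in> carrier M"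
  then obtain \<theta> where \<theta>: "\<theta> \<in> endos" "C = mat \<theta>"
    using mat_surj by metis
  have "compose (carrier G) (compose (carrier G) \<phi> \<psi>) \<theta> = compose (carrier G) \<phi> (compose (carrier G) \<psi> \<theta>)"
    using compose_assoc[of \<theta> "carrier G" "carrier G" \<phi> \<psi>] \<theta> endos_closed by auto
  then show "A \<otimes>\<^bsub>M\<^esub> B \<otimes>\<^bsub>M\<^esub> C = A \<otimes>\<^bsub>M\<^esub> (B \<otimes>\<^bsub>M\<^esub> C)"
    using * \<theta> by (simp add: mat_compose[symmetric] endos_compose)
qed

text \<open>An inverse automorphism gives an inverse matrix. Conversely an inverse matrix is
  \<open>mat \<psi>\<close> for some endomorphism \<open>\<psi>\<close>, and injectivity of
  \<open>mat\<close> turns the two matrix identities into \<open>\<psi>\<close> being a two-sided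
  inverse.\<close>

lemma mat_image_auto: "mat ` auto G = Units M"
proof (intro equalityI subsetI)
  fix A assume "A \<in> mat ` auto G"
  then obtain \<phi> where \<phi>: "\<phi> \<in> auto G" "A = mat \<phi>" by blast
  obtain \<psi> where \<psi>: "\<psi> \<in> auto G" "\<And>x. x \<in> carrier G \<Longrightarrow> \<psi> (\<phi> x) = x \<and> \<phi> (\<psi> x) = x"
    using auto_inv[OF \<phi>(1)] by blast
  have "compose (carrier G) \<phi> \<psi> = (\<lambda>x \<in> carrier G. x)" "compose (carrier G) \<psi> \<phi> = (\<lambda>x \<in> carrier G. x)"
    using \<psi>(2) by (auto simp: compose_def)
  then have "mat \<phi> \<otimes>\<^bsub>M\<^esub> mat \<psi> = \<one>\<^bsub>M\<^esub>" "mat \<psi> \<otimes>\<^bsub>M\<^esub> mat \<phi> = \<one>\<^bsub>M\<^esub>"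
    using \<phi>(1) \<psi>(1) auto_subset_endos by (metis mat_compose mat_id subsetD)+
  then show "A \<in> Units M"
    using \<phi> \<psi>(1) mat_in auto_subset_endos unfolding Units_def by blast
next
  fix A assume "A \<in> Units M"
  then obtain B where AB: "A \<in> carrier M" "B \<in> carrier M" "A \<otimes>\<^bsub>M\<^esub> B = \<one>\<^bsub>M\<^esub>" "B \<otimes>\<^bsub>M\<^esub> A = \<one>\<^bsub>M\<^esub>"
    by (auto simp: Units_def)
  then obtain \<phi> \<psi> where *: "\<phi> \<in> endos" "\<psi> \<in> endos" "A = mat \<phi>" "B = mat \<psi>"
    using mat_surj by metis
  have "compose (carrier G) \<phi> \<psi> = (\<lambda>x \<in> carrier G. x)" "compose (carrier G) \<psi> \<phi> = (\<lambda>x \<in> carrier G. x)"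
    using AB(3,4) *
    by (simp_all add: inj_on_eq_iff[OF mat_inj, symmetric] endos_compose id_endos mat_compose mat_id)
  then have inv: "\<phi> (\<psi> x) = x" "\<psi> (\<phi> x) = x" if "x \<in> carrier G" for x
    using that by (metis compose_eq restrict_apply')+
  have "bij_betw \<phi> (carrier G) (carrier G)"
    by (rule bij_betw_byWitness[where f' = \<psi>]) (use * inv endos_closed in auto)
  then have "\<phi> \<in> auto G"
    using *(1) by (simp add: endos_def auto_def Bij_def)
  with * show "A \<in> mat ` auto G" by blast
qed

lemma mat_iso: "mat \<in> iso (AutoGroup G) (GL 2 (residue_ring (int p)))"
proof (rule isoI)
  show "bij_betw mat (carrier (AutoGroup G)) (carrier (GL 2 (residue_ring (int p))))"
    using mat_image_auto inj_on_subset[OF mat_inj auto_subset_endos]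
    by (simp add: bij_betw_def GL_def units_of_carrier)
  then show "mat \<in> hom (AutoGroup G) (GL 2 (residue_ring (int p)))"
    using auto_subset_endos
    by (intro homI) (auto simp: mult_AutoGroup GL_def units_of_mult mat_compose subset_iff dest: bij_betwE)
qed

section \<open>Scalar matrices and the projective group\<close>

text \<open>In a finite group the span of \<open>x\<close> consists of powers with natural
  exponents. The point is that a single \<open>n\<close> serves all coordinates: \<open>y\<close> is
  a scalar multiple of \<open>x\<close>.\<close>

lemma coord_generate:
  assumes "x \<in> carrier G" "y \<in> generate G {x}"
  obtains n :: nat where "\<And>i. coord i y = (int n * coord i x) mod int p"
  using assms(2) coord_pow[OF assms(1)] generate_pow_on_finite_carrier[OF finite_carrier assms(1)]
  by auto

text \<open>Fixing the two coordinate axes makes the matrix diagonal; fixing the line through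
  $(1, 1)$ then makes it scalar.\<close>

lemma scalar_iff:
  assumes \<phi>: "\<phi> \<in> auto G"
  shows "(\<forall>x \<in> carrier G. (x, \<phi> x) \<in> gen_equiv G) \<longleftrightarrow> mat \<phi> \<in> scalar_matrices 2 (residue_ring (int p))"
proof
  have closed: "\<phi> x \<in> carrier G" if "x \<in> carrier G" for x
    using auto_closed[OF \<phi> that] .
  have hom: "\<phi> \<in> hom G G" using \<phi> by (simp add: auto_def)
  {
    assume "\<forall>x \<in> carrier G. (x, \<phi> x) \<in> gen_equiv G"
    then have gen: "\<phi> x \<in> generate G {x}" if "x \<in> carrier G" for x
      using that gen_equiv_iff[OF that closed[OF that]] generate.incl[of "\<phi> x" "{\<phi> x}" G] by simp
    \<comment> \<open>The \<open>i\<close>-th coordinate of \<open>basis j\<close> is 0, and so is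
      that of all its multiples.\<close>
    have off_diag: "coord i (\<phi> (basis j)) = 0" if "i < 2" "i \<noteq> j" for i j
      using coord_generate[OF basis_in gen[OF basis_in]] that coord_basis by (metis mod_0 mult_zero_right)
    let ?s = "of_coord (\<lambda>_. 1)"
    \<comment> \<open>A multiple of (1, 1) has equal coordinates; once the matrix is diagonal, these
      are its two diagonal entries.\<close>
    have "coord 0 (\<phi> ?s) = coord 1 (\<phi> ?s)"
      using coord_generate[OF of_coord_in gen[OF of_coord_in]]
      by (metis coord_of_coord one_less_numeral_iff semiring_norm(76) zero_less_numeral)
    then have "coord 0 (\<phi> (basis 0)) = coord 1 (\<phi> (basis 1))"
      using hom_coord[OF hom of_coord_in, of 0 "\<lambda>_. 1"] hom_coord[OF hom of_coord_in, of 1 "\<lambda>_. 1"] off_diag p_gt_1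
      by (simp add: sum_less_2 coord_of_coord coord_mod closed basis_in)
    then have "mat \<phi> = (\<lambda>i \<in> {..<2}. \<lambda>j \<in> {..<2}. if i = j then coord 0 (\<phi> (basis 0)) else 0)"
      using off_diag by (auto simp: mat_def less_2_cases_iff intro!: restrict_ext)
    moreover have "coord 0 (\<phi> (basis 0)) \<in> carrier (residue_ring (int p))"
      using coord_range[OF closed[OF basis_in], of 0 0] by (simp add: residue_ring_simps)
    ultimately show "mat \<phi> \<in> scalar_matrices 2 (residue_ring (int p))"
      unfolding scalar_matrices_def residue_ring_simps by blast
  next
    assume "mat \<phi> \<in> scalar_matrices 2 (residue_ring (int p))"
    then obtain c where c: "c \<in> {0..<int p}"
      and m: "mat \<phi> = (\<lambda>i \<in> {..<2}. \<lambda>j \<in> {..<2}. if i = j then c else 0)"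
      unfolding scalar_matrices_def residue_ring_simps by blast
    define n where "n = nat c"
    have n: "int n = c" using c by (simp add: n_def)
    have entry: "coord i (\<phi> (basis j)) = (if i = j then c else 0)" if "i < 2" "j < 2" for i j
      using fun_cong[OF fun_cong[OF m, of i], of j] that by (simp add: mat_def)
    show "\<forall>x \<in> carrier G. (x, \<phi> x) \<in> gen_equiv G"
    proof
      fix x assume x: "x \<in> carrier G"
      \<comment> \<open>A scalar matrix acts as a power map, which keeps \<open>x\<close> in its
        span; injectivity of \<open>\<phi>\<close> then keeps a nontrivial \<open>x\<close>
        nontrivial, hence in its class.\<close>
      have pow: "\<phi> x = x [^] n"
      proof (rule coord_eqI)
        show "coord i (\<phi> x) = coord i (x [^] n)" if "i < 2" for i
          using that entry x n by (auto simp: hom_coord[OF hom x] coord_pow sum_less_2 less_2_cases_iff)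
      qed (use x closed in auto)
      then have gen: "\<phi> x \<in> generate G {x}"
        using generate_pow_on_finite_carrier[OF finite_carrier x] by auto
      show "(x, \<phi> x) \<in> gen_equiv G"
      proof (cases "x = \<one>")
        case True
        then show ?thesis using gen generate_one_eq by (simp add: gen_equiv_iff)
      next
        case False
        interpret group_hom G G \<phi>
          using hom by unfold_locales
        have "\<phi> x \<noteq> \<phi> \<one>"
          using inj_onD[of \<phi> "carrier G" x \<one>] \<phi> x False by (auto simp: auto_def Bij_def bij_betw_def)
        then show ?thesis
          using gen_equiv_iff_mem[OF x closed[OF x] False] gen by simp
      qed
    qed
  }
qed

text \<open>The map \<open>?g\<close> turns matrices back into automorphisms, so that the first
  isomorphism theorem is applied to a homomorphism defined on the very group that \<open>PGL\<close>
  divides. By \<open>scalar_iff\<close> its kernel is the subgroup occurring in the definition of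
  \<open>PGL\<close>.\<close>

lemma induced_Aut_PGL: "induced_Aut G \<cong> PGL 2 (residue_ring (int p))"
proof -
  let ?GL = "GL 2 (residue_ring (int p))" and ?S = "scalar_matrices 2 (residue_ring (int p))"
  let ?g = "inv_into (auto G) mat"
  have GL: "group ?GL"
    using monoid.units_group[OF monoid_M] by (simp add: GL_def)
  have g: "?g \<in> iso ?GL (AutoGroup G)"
    using group.iso_set_sym[OF AutoGroup mat_iso] by simp
  interpret A: group_hom "AutoGroup G" "induced_Aut G" "class_action G"
    by (rule group_hom_class_action)
  interpret h: group_hom ?GL "induced_Aut G" "class_action G \<circ> ?g"
    using GL A.H.group_axioms Group.hom_compose[OF iso_imp_homomorphism[OF g] A.homh]
    by (simp add: group_hom_def group_hom_axioms_def)
  have g_bij: "bij_betw ?g (carrier ?GL) (auto G)"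
    using g by (simp add: iso_def)
  have mat_g: "mat (?g A) = A" if "A \<in> carrier ?GL" for A
    using that mat_image_auto by (simp add: f_inv_into_f GL_def units_of_carrier)
  have "A \<in> kernel ?GL (induced_Aut G) (class_action G \<circ> ?g) \<longleftrightarrow> A \<in> carrier ?GL \<inter> ?S" for A
  proof (cases "A \<in> carrier ?GL")
    case True
    then have g_A: "?g A \<in> auto G" using bij_betwE[OF g_bij] by blast
    then have "class_action G (?g A) = \<one>\<^bsub>induced_Aut G\<^esub> \<longleftrightarrow> mat (?g A) \<in> ?S"
      using kernel_class_action scalar_iff[OF g_A] unfolding kernel_def carrier_AutoGroup by blast
    then show ?thesis using True mat_g by (simp add: kernel_def)
  qed (simp add: kernel_def)
  then have ker: "kernel ?GL (induced_Aut G) (class_action G \<circ> ?g) = carrier ?GL \<inter> ?S"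
    by blast
  have "(class_action G \<circ> ?g) ` carrier ?GL = carrier (induced_Aut G)"
    using bij_betw_imp_surj_on[OF g_bij] by (simp only: carrier_induced_Aut flip: image_comp)
  then have "PGL 2 (residue_ring (int p)) \<cong> induced_Aut G"
    using h.FactGroup_iso unfolding ker PGL_def by blast
  \<comment> \<open>Reversing the isomorphism needs its domain to be a group; the invertible scalar
    matrices are normal because they form a kernel.\<close>
  moreover have "group (PGL 2 (residue_ring (int p)))"
    using normal.factorgroup_is_group[OF h.normal_kernel] unfolding ker PGL_def .
  ultimately show ?thesis by (rule group.iso_sym[rotated])
qed

end

theorem proposition5p5:
  fixes p :: nat and G :: "('a, 'b) monoid_scheme"
  assumes "Factorial_Ring.prime p"
    and "group G"
    and "G \<cong> integer_mod_group p \<times>\<times> integer_mod_group p"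
  shows "card (pverts (reduced_gen_graph G)) = p + 2 \<and>
    AutoGroup G \<cong> GL 2 (residue_ring (int p)) \<and>
    induced_Aut G \<cong> PGL 2 (residue_ring (int p)) \<and>
    graph_Aut (reduced_gen_graph G) \<cong> sym_group (p + 1) \<and>
    weighted_graph_Aut (weighted_reduced_gen_graph G) \<cong> sym_group (p + 1) \<and>
    (\<forall>C. isolated (reduced_gen_graph G) C \<longleftrightarrow> C = gen_equiv G `` {\<one>\<^bsub>G\<^esub>}) \<and>
    (\<forall>f \<in> carrier (graph_Aut (reduced_gen_graph G)) \<union>
           carrier (weighted_graph_Aut (weighted_reduced_gen_graph G)).
         f (gen_equiv G `` {\<one>\<^bsub>G\<^esub>}) = gen_equiv G `` {\<one>\<^bsub>G\<^esub>}) \<and>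
    graph_Aut (gen_graph G) \<cong>
         wreath_product (sym_group (p - 1)) (sym_group (p + 1)) {1..p + 1}"
proof -
  obtain f where "f \<in> iso G (integer_mod_group p \<times>\<times> integer_mod_group p)"
    using assms(3) by (auto simp: is_iso_def)
  then interpret rank2_coordinates G p f
    using assms(1,2) by (simp add: rank2_coordinates_def rank2_coordinates_axioms_def)
  obtain \<beta> where "multipartite_with_isolated (gen_graph G) \<one>\<^bsub>G\<^esub> \<beta> (p + 1) (p - 1)"
    by (rule multipartite_gen_graph)
  then interpret \<Gamma>: multipartite_with_isolated "gen_graph G" "\<one>\<^bsub>G\<^esub>" \<beta> "p + 1" "p - 1" .
  obtain \<beta>' where "multipartite_with_isolated (reduced_gen_graph G) {\<one>\<^bsub>G\<^esub>} \<beta>' (p + 1) 1"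
    by (rule multipartite_reduced_gen_graph)
  then interpret R: multipartite_with_isolated "reduced_gen_graph G" "{\<one>\<^bsub>G\<^esub>}" \<beta>' "p + 1" 1 .
  show ?thesis
    \<comment> \<open>This reduces the weighted claims to the unweighted ones and turns the class of
      the identity into \<open>{\<one>}\<close>, the isolated vertex of \<open>R\<close>.\<close>
    unfolding weighted_graph_Aut_eq cls_one
    using card_pverts_reduced is_isoI[OF mat_iso] induced_Aut_PGL R.graph_Aut_sym_group
      R.isolated_iff R.graph_aut_fixes \<Gamma>.graph_Aut_wreath_product by simp
qed

end
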